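(* $G\in\mathcal{B}_2$ if and only if $G$ is a $5$-group of exponent $5$ or the Sylow $5$-subgroup of $G$ is a group of exponent $5$ and has index $2$ in $G$.
   Context: All groups are finite, and $G$ denotes a group. For a group $G$ and a subset $S\subseteq G$ with $1_G\notin S=S^{-1}$, $\mathrm{Cay}(G,S)$ is the undirected graph with vertex set $G$ in which $g,h$ are adjacent if and only if $hg^{-1}\in S$. A graph $\Gamma$ is $2$-integral if $[\mathbb{SF}(\Gamma):\mathbb{Q}]=2$, where $\mathbb{SF}(\Gamma)$ is the smallest field extension of $\mathbb{Q}$ containing all eigenvalues of the adjacency matrix of $\Gamma$. For an integer $k\geq 2$, $\mathcal{B}_k$ is the set of all groups $G$ such that $\mathrm{Cay}(G,S)$ is $2$-integral whenever $S\subset G$ satisfies $1_G\notin S=S^{-1}$ and $2\leq|S|\leq k$.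
   Formalization: The group G is assumed to have order greater than 2; groups of order 1 and 2 have no S with |S| = 2 and 1 not in S, so they lie in B_2 vacuously, but they have no subgroup of exponent 5, so the statement fails for them. *)

theory Defs
  imports
    "HOL-Algebra.Sylow"
    "HOL-Algebra.Generated_Fields"
    "HOL-Algebra.Embedded_Algebras"
    "HOL-Algebra.Algebraic_Closure_Type"
    "Graph_Theory.Pair_Digraph"
    "Jordan_Normal_Form.Char_Poly"
begin

section \<open>Splitting fields of graphs\<close>

text \<open>Undirected graphs are represented by digraphs with a symmetric arc relation
  (locale \<^locale>\<open>pair_graph\<close>).\<close>

definition adjacency_matrix :: "'a pair_pre_digraph \<Rightarrow> 'a list \<Rightarrow> complex mat" where
  "adjacency_matrix \<Gamma> vs =
     mat (length vs) (length vs) (\<lambda>(i, j). if (vs ! i, vs ! j) \<in> parcs \<Gamma> then 1 else 0)"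

text \<open>Another enumeration of the vertices conjugates the adjacency matrix by a permutation
  matrix, so the eigenvalues do not depend on \<open>vs\<close>.\<close>

definition graph_eigenvalues :: "'a pair_pre_digraph \<Rightarrow> complex set" where
  "graph_eigenvalues \<Gamma> =
     {x. \<exists>vs. distinct vs \<and> set vs = pverts \<Gamma> \<and> eigenvalue (adjacency_matrix \<Gamma> vs) x}"

definition splitting_field :: "'a pair_pre_digraph \<Rightarrow> complex set" where
  "splitting_field \<Gamma> =
     generate_field (ring_of_type_algebra :: complex ring) (\<rat> \<union> graph_eigenvalues \<Gamma>)"

definition two_integral :: "'a pair_pre_digraph \<Rightarrow> bool" where
  "two_integral \<Gamma> \<longleftrightarrow>
     ring.dimension (ring_of_type_algebra :: complex ring) 2 \<rat> (splitting_field \<Gamma>)"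


section \<open>Cayley graphs\<close>

definition cayley_graph :: "('a, 'b) monoid_scheme \<Rightarrow> 'a set \<Rightarrow> 'a pair_pre_digraph" where
  "cayley_graph G S =
     \<lparr>pverts = carrier G,
      parcs = {(g, h). g \<in> carrier G \<and> h \<in> carrier G \<and> h \<otimes>\<^bsub>G\<^esub> inv\<^bsub>G\<^esub> g \<in> S}\<rparr>"

definition connection_set :: "('a, 'b) monoid_scheme \<Rightarrow> 'a set \<Rightarrow> bool" where
  "connection_set G S \<longleftrightarrow> S \<subseteq> carrier G \<and> \<one>\<^bsub>G\<^esub> \<notin> S \<and> S = set_inv\<^bsub>G\<^esub> S"

lemma pair_graph_cayley_graph:
  assumes "group G" and "finite (carrier G)" and "connection_set G S"
  shows "pair_graph (cayley_graph G S)"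
proof -
  interpret group G by fact
  have arcs: "finite {(g, h). g \<in> carrier G \<and> h \<in> carrier G \<and> h \<otimes>\<^bsub>G\<^esub> inv\<^bsub>G\<^esub> g \<in> S}"
    by (rule finite_subset[of _ "carrier G \<times> carrier G"]) (use assms in auto)
  have sym: "g \<otimes>\<^bsub>G\<^esub> inv\<^bsub>G\<^esub> h \<in> S"
    if "g \<in> carrier G" "h \<in> carrier G" "h \<otimes>\<^bsub>G\<^esub> inv\<^bsub>G\<^esub> g \<in> S" for g h
  proof -
    have "inv\<^bsub>G\<^esub> (h \<otimes>\<^bsub>G\<^esub> inv\<^bsub>G\<^esub> g) \<in> set_inv\<^bsub>G\<^esub> S"
      using that(3) by (auto simp: SET_INV_def)
    then show ?thesis
      using that assms(3) by (simp add: connection_set_def inv_mult_group)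
  qed
  show ?thesis
  proof
    show "symmetric (with_proj (cayley_graph G S))"
      using sym unfolding symmetric_def sym_def by (simp add: cayley_graph_def)
    show "fst e \<noteq> snd e" if "e \<in> parcs (cayley_graph G S)" for e
      using that assms(3) unfolding cayley_graph_def connection_set_def by auto
  qed (use assms(2) arcs in \<open>auto simp: cayley_graph_def\<close>)
qed

definition class_B :: "nat \<Rightarrow> ('a, 'b) monoid_scheme set" where
  "class_B k =
     {G. group G \<and> finite (carrier G) \<and>
         (\<forall>S. connection_set G S \<and> 2 \<le> card S \<and> card S \<le> k \<longrightarrow> two_integral (cayley_graph G S))}"

text \<open>Groups of order at most 2 have no connection set with two elements, so they lie in every
  \<^const>\<open>class_B\<close> vacuously; yet they have no subgroup of exponent 5.  Classifications of
  \<^const>\<open>class_B\<close> by exponents therefore have to assume \<open>order G > 2\<close>.\<close>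

lemma order_le_two_class_B:
  assumes "group G" and "finite (carrier G)" and "Coset.order G \<le> 2"
  shows "G \<in> class_B k"
proof -
  interpret group G by fact
  have "card S < 2" if "connection_set G S" for S
  proof -
    have "S \<subset> carrier G"
      using that one_closed unfolding connection_set_def by blast
    then have "card S < card (carrier G)"
      by (rule psubset_card_mono[OF assms(2)])
    then show ?thesis
      using assms(3) unfolding Coset.order_def by linarith
  qed
  then have "\<not> (connection_set G S \<and> 2 \<le> card S \<and> card S \<le> k)" for S
    using leD by blast
  then show ?thesis
    using assms unfolding class_B_def by blast
qed


section \<open>Sylow subgroups and exponents\<close>

definition p_group :: "nat \<Rightarrow> ('a, 'b) monoid_scheme \<Rightarrow> bool" where
  "p_group p G \<longleftrightarrow> group G \<and> (\<exists>n. Coset.order G = p ^ n)"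

definition sylow_subgroup :: "nat \<Rightarrow> 'a set \<Rightarrow> ('a, 'b) monoid_scheme \<Rightarrow> bool" where
  "sylow_subgroup p P G \<longleftrightarrow> subgroup P G \<and> card P = p ^ multiplicity p (Coset.order G)"

text \<open>The value is meaningful for finite groups, where such an \<open>n\<close> exists.\<close>

definition group_exponent :: "('a, 'b) monoid_scheme \<Rightarrow> nat" where
  "group_exponent G = (LEAST n. n > 0 \<and> (\<forall>x\<in>carrier G. x [^]\<^bsub>G\<^esub> n = \<one>\<^bsub>G\<^esub>))"

definition subgroup_index :: "('a, 'b) monoid_scheme \<Rightarrow> 'a set \<Rightarrow> nat" where
  "subgroup_index G H = card (rcosets\<^bsub>G\<^esub> H)"

end

theory Submission
  imports Defs
begin

text \<open>A connection set with two elements is either \<open>{x, inverse x}\<close> with \<open>x\<close> of order \<open>n \<ge> 3\<close> or a pair of involutions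
  \<open>s, t\<close>, so the Cayley graph is a disjoint union of cycles, of length \<open>n\<close> or \<open>2 \<cdot> ord (ts)\<close>. The
  eigenvalues of a cycle of length \<open>n\<close> are the numbers \<open>w + inverse w\<close> with \<open>w ^ n = 1\<close>.

  If such a number has degree at most two over the rationals, then it and its conjugate are algebraic
  integers in \<open>[-2, 2]\<close>, which leaves finitely many integral quadratics and forces
  \<open>w ^ 8 = 1\<close>, \<open>w ^ 10 = 1\<close> or \<open>w ^ 12 = 1\<close>. Cycles of length 3 and 4 have rational spectrum, so a
  group in the class has no elements of order 3 or 4; hence \<open>x ^ 10 = 1\<close> for all \<open>x\<close>. For the same
  reason distinct involutions do not commute, so 4 does not divide the group order. By Sylow's theorem
  the order is \<open>5 ^ b\<close> or \<open>2 \<cdot> 5 ^ b\<close>. Conversely, in the groups described only cycles of length 5 and 10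
  occur, whose splitting field is generated by the square root of 5.\<close>

section \<open>Roots of unity of small degree\<close>

text \<open>These are the rescaled Chebyshev polynomials \<open>2 T_n(X/2)\<close>, the integer
  polynomials that turn \<open>w + 1/w\<close> into \<open>w ^ n + 1/w ^ n\<close>. The value 2 at
  index 0 is \<open>w ^ 0 + v ^ 0\<close>.\<close>

fun dickson :: "nat \<Rightarrow> int poly" where
  "dickson 0 = [:2:]"
| "dickson (Suc 0) = [:0, 1:]"
| "dickson (Suc (Suc n)) = [:0, 1:] * dickson (Suc n) - dickson n"

lemma poly_dickson:
  fixes w v :: complex
  assumes "w * v = 1"
  shows "poly (of_int_poly (dickson n)) (w + v) = w ^ n + v ^ n"
proof (induction n rule: dickson.induct)
  case (3 n)
  have v: "w * (v * x) = x" "v * (w * x) = x" for x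
    using assms by (simp_all add: mult.assoc[symmetric] mult.commute)
  have "poly (of_int_poly (dickson (Suc (Suc n)))) (w + v) =
      (w + v) * (w ^ Suc n + v ^ Suc n) - (w ^ n + v ^ n)"
    using 3 by (simp add: hom_distribs)
  also have "\<dots> = w ^ Suc (Suc n) + v ^ Suc (Suc n)"
    by (simp add: distrib_left distrib_right v)
  finally show ?case .
qed auto

text \<open>Multiplication by \<open>X\<close> raises the degree by one, and the subtracted
  polynomial has degree two less than the product. Monicity, which fails for the constant 2 at index
  0, makes \<open>w + v\<close> an algebraic integer when \<open>w\<close> is a root of
  unity.\<close>

lemma degree_dickson: "degree (dickson n) = n"
  and lead_coeff_dickson: "n > 0 \<Longrightarrow> lead_coeff (dickson n) = 1"
proof -
  have "degree (dickson n) = n \<and> (n > 0 \<longrightarrow> coeff (dickson n) n = 1)"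
  proof (induction n rule: dickson.induct)
    case (3 n)
    have "dickson (Suc n) \<noteq> 0"
      using 3 by auto
    then have d: "degree (pCons 0 (dickson (Suc n))) = Suc (Suc n)"
      using 3 by simp
    then have "degree (pCons 0 (dickson (Suc n)) - dickson n) = Suc (Suc n)"
      using 3 by (metis degree_add_eq_left degree_minus diff_conv_add_uminus less_Suc_eq less_SucI)
    moreover have "coeff (pCons 0 (dickson (Suc n)) - dickson n) (Suc (Suc n)) = 1"
      using 3 by (simp add: coeff_eq_0)
    ultimately show ?case
      by simp
  qed auto
  then show "degree (dickson n) = n" "n > 0 \<Longrightarrow> lead_coeff (dickson n) = 1"
    by auto
qed

text \<open>Since \<open>w\<close> lies on the unit circle, \<open>v\<close> is its complex
  conjugate and the sum is \<open>2 * Re w\<close>.\<close>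

lemma unity_add_inverse_bounded:
  fixes w v :: complex
  assumes "w ^ n = 1" and "n > 0" and "w * v = 1"
  obtains r where "w + v = of_real r" and "\<bar>r\<bar> \<le> 2"
proof
  have "norm w ^ n = 1"
    using arg_cong[OF assms(1), of norm] by (simp add: norm_power)
  then have n: "norm w = 1"
    using assms(2) power_eq_imp_eq_base[of "norm w" n 1] by simp
  then have "w * cnj w = 1"
    by (simp add: complex_norm_square[symmetric])
  then have "v = cnj w"
    using assms(3) by (metis mult_cancel_left mult_zero_left zero_neq_one)
  then show "w + v = of_real (2 * Re w)"
    by (simp add: complex_eq_iff)
  show "\<bar>2 * Re w\<bar> \<le> 2"
    using abs_Re_le_cmod[of w] n by simp
qed

text \<open>The two roots of \<open>X^2 - z X + 1\<close> have sum \<open>z\<close> and product 1;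
  the quadratic formula gives \<open>w\<close>.\<close>

lemma exists_joukowski_preimage:
  fixes z :: complex
  obtains w v where "w * v = 1" and "z = w + v"
proof -
  define w where "w = (z + csqrt (z\<^sup>2 - 4)) / 2"
  have "(csqrt (z\<^sup>2 - 4))\<^sup>2 = z\<^sup>2 - 4"
    by (rule power2_csqrt)
  then have "w * (z - w) = 1"
    by (simp add: w_def field_simps power2_eq_square)
  then show ?thesis
    by (rule that) simp
qed

text \<open>Writing \<open>z = w + v\<close>, the equation \<open>w ^ n + v ^ n = 2\<close> forces
  \<open>(w ^ n - 1)^2 = 0\<close>. Thus every complex root of \<open>dickson n - 2\<close> comes
  from an \<open>n\<close>-th root of unity, which bounds all conjugates of such a number without
  Galois theory.\<close>

lemma dickson_eq_two:
  fixes z :: complex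
  assumes "poly (of_int_poly (dickson n)) z = 2" and "n > 0"
  obtains r where "z = of_real r" and "\<bar>r\<bar> \<le> 2"
proof -
  obtain w v where wv: "w * v = 1" and z: "z = w + v"
    by (rule exists_joukowski_preimage)
  have sum: "w ^ n + v ^ n = 2"
    using assms(1) poly_dickson[OF wv, of n] by (simp add: z)
  have "w ^ n * v ^ n = 1"
    using wv by (simp add: power_mult_distrib[symmetric])
  then have "(w ^ n - 1)\<^sup>2 = w ^ n * (w ^ n + v ^ n - 2)"
    by (simp add: algebra_simps power2_eq_square)
  then have "w ^ n = 1"
    using sum by simp
  then show ?thesis
    using that unity_add_inverse_bounded[OF _ assms(2) wv] by (auto simp: z)
qed

text \<open>A form of Gauss' lemma: pseudo-division of \<open>g\<close> by \<open>m\<close> leaves no remainder by minimality, and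
  comparing contents and leading coefficients makes the leading coefficient of \<open>m\<close> a unit.\<close>

lemma lead_coeff_dvd_one_if_minimal:
  fixes m g :: "int poly" and z :: complex
  assumes "content m = 1" and "poly (of_int_poly m) z = 0"
    and "\<And>p :: int poly. p \<noteq> 0 \<Longrightarrow> poly (of_int_poly p) z = 0 \<Longrightarrow> degree m \<le> degree p"
    and "lead_coeff g = 1" and "poly (of_int_poly g) z = 0"
  obtains k q where "smult k g = m * q" and "k \<noteq> 0" and "lead_coeff m dvd 1"
proof -
  have m0: "m \<noteq> 0"
    using assms(1) by auto
  obtain q r where qr: "pseudo_divmod g m = (q, r)"
    by (cases "pseudo_divmod g m")
  define k where "k = lead_coeff m ^ (Suc (degree g) - degree m)"
  have k0: "k \<noteq> 0"
    using m0 by (simp add: k_def)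
  have eq: "smult k g = m * q + r" and r: "r = 0 \<or> degree r < degree m"
    using pseudo_divmod[OF m0 qr] by (auto simp: k_def)
  have "poly (of_int_poly (smult k g)) z = poly (of_int_poly (m * q + r)) z"
    by (simp add: eq)
  then have "poly (of_int_poly r) z = 0"
    using assms(2,5) by (simp add: hom_distribs)
  then have "r = 0"
    using r assms(3)[of r] by force
  then have eq: "smult k g = m * q"
    using eq by simp
  have "content g dvd lead_coeff g"
    by (rule content_dvd_coeff)
  then have "content g = 1"
    using assms(4) by (metis is_unit_content_iff)
  then have "content q = \<bar>k\<bar>"
    using arg_cong[OF eq, of content] assms(1) by (simp add: content_mult)
  then have "k dvd lead_coeff q"
    by (metis abs_dvd_iff content_dvd_coeff)
  then obtain t where "lead_coeff q = k * t"
    by blast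
  moreover have "lead_coeff (smult k g) = k"
    using assms(4) by simp
  ultimately have "k = lead_coeff m * (k * t)"
    using eq by (simp add: lead_coeff_mult)
  then have "lead_coeff m * t = 1"
    using k0 by simp
  then have "lead_coeff m dvd 1"
    by (metis dvd_triv_left)
  then show ?thesis
    using that eq k0 by blast
qed

section \<open>Roots of unity of small order\<close>

text \<open>Palindromic factors become polynomials in \<open>w + v\<close> after division by a power
  of \<open>w\<close>. All identities follow from \<open>w * (w + v) = w^2 + 1\<close> and its
  square.\<close>

lemma joukowski_factorization:
  fixes w v :: complex
  assumes "w * v = 1"
  shows "(w - 1)\<^sup>2 = w * ((w + v) - 2)" "(w + 1)\<^sup>2 = w * ((w + v) + 2)"
    "w ^ 3 - 1 = (w - 1) * w * ((w + v) + 1)" "w ^ 3 + 1 = (w + 1) * w * ((w + v) - 1)"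
    "w ^ 4 - 1 = (w\<^sup>2 - 1) * w * (w + v)" "w ^ 4 + 1 = w\<^sup>2 * ((w + v)\<^sup>2 - 2)"
    "w ^ 6 + 1 = (w\<^sup>2 + 1) * w\<^sup>2 * ((w + v)\<^sup>2 - 3)"
    "w ^ 5 - 1 = (w - 1) * w\<^sup>2 * ((w + v)\<^sup>2 + (w + v) - 1)"
    "w ^ 5 + 1 = (w + 1) * w\<^sup>2 * ((w + v)\<^sup>2 - (w + v) - 1)"
proof -
  have wz: "w * (w + v) = w\<^sup>2 + 1"
    using assms by (simp add: algebra_simps power2_eq_square)
  then have "w\<^sup>2 * (w + v)\<^sup>2 = (w\<^sup>2 + 1)\<^sup>2"
    by (simp flip: power_mult_distrib)
  then show "(w - 1)\<^sup>2 = w * ((w + v) - 2)" "(w + 1)\<^sup>2 = w * ((w + v) + 2)"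
    "w ^ 3 - 1 = (w - 1) * w * ((w + v) + 1)" "w ^ 3 + 1 = (w + 1) * w * ((w + v) - 1)"
    "w ^ 4 - 1 = (w\<^sup>2 - 1) * w * (w + v)" "w ^ 4 + 1 = w\<^sup>2 * ((w + v)\<^sup>2 - 2)"
    "w ^ 6 + 1 = (w\<^sup>2 + 1) * w\<^sup>2 * ((w + v)\<^sup>2 - 3)"
    "w ^ 5 - 1 = (w - 1) * w\<^sup>2 * ((w + v)\<^sup>2 + (w + v) - 1)"
    "w ^ 5 + 1 = (w + 1) * w\<^sup>2 * ((w + v)\<^sup>2 - (w + v) - 1)"
    using wz by Groebner_Basis.algebra+
qed

text \<open>Each listed value annihilates one right-hand side in
  \<open>joukowski_factorization\<close>. The orders that arise are 1, 2, 3, 4, 5, 6, 8, 10 and 12,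
  and each divides 8, 10 or 12.\<close>

lemma joukowski_root_of_unity:
  fixes w v :: complex
  assumes "w * v = 1"
    and "(\<exists>e\<in>{-2, -1, 0, 1, 2}. w + v = e) \<or> (w + v)\<^sup>2 = 2 \<or> (w + v)\<^sup>2 = 3 \<or>
      (w + v)\<^sup>2 + (w + v) = 1 \<or> (w + v)\<^sup>2 - (w + v) = 1"
  shows "w ^ 8 = 1 \<or> w ^ 10 = 1 \<or> w ^ 12 = 1"
proof -
  have "w + v = 2 \<Longrightarrow> w - 1 = 0" "w + v = -2 \<Longrightarrow> w + 1 = 0" "w + v = -1 \<Longrightarrow> w ^ 3 - 1 = 0"
    "w + v = 1 \<Longrightarrow> w ^ 3 + 1 = 0" "w + v = 0 \<Longrightarrow> w ^ 4 - 1 = 0"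
    "(w + v)\<^sup>2 = 2 \<Longrightarrow> w ^ 4 + 1 = 0" "(w + v)\<^sup>2 = 3 \<Longrightarrow> w ^ 6 + 1 = 0"
    "(w + v)\<^sup>2 + (w + v) = 1 \<Longrightarrow> w ^ 5 - 1 = 0" "(w + v)\<^sup>2 - (w + v) = 1 \<Longrightarrow> w ^ 5 + 1 = 0"
    using joukowski_factorization[OF assms(1)] by auto
  then have "(w ^ 4 = 1 \<or> w ^ 4 = -1) \<or> (w ^ 5 = 1 \<or> w ^ 5 = -1) \<or>
      (w ^ 3 = 1 \<or> w ^ 3 = -1) \<or> w ^ 6 = -1"
    using assms(2) by (auto simp: add_eq_0_iff2)
  then have "(w ^ 4)\<^sup>2 = 1 \<or> (w ^ 5)\<^sup>2 = 1 \<or> (w ^ 6)\<^sup>2 = 1"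
    unfolding power2_eq_1_iff using power2_eq_1_iff[of "w ^ 3"] by (simp flip: power_mult)
  then show ?thesis
    by (simp flip: power_mult)
qed

text \<open>In \<open>p^2 = 5 * q^2\<close> the exponent of 5 is even on the left and odd on the
  right.\<close>

lemma irrational_if_square_eq_five:
  fixes x :: complex
  assumes "x\<^sup>2 = 5"
  shows "x \<notin> \<rat>"
proof
  assume "x \<in> \<rat>"
  then obtain p q where pq: "q > 0" "x = of_int p / of_int q"
    by (metis Rats_cases')
  then have "of_int p = x * of_int q"
    by simp
  then have "(of_int p)\<^sup>2 = (5 :: complex) * (of_int q)\<^sup>2"
    by (simp add: power_mult_distrib assms)
  then have "of_int (p\<^sup>2) = (of_int (5 * q\<^sup>2) :: complex)"
    by simp
  then have eq: "p\<^sup>2 = 5 * q\<^sup>2"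
    by (simp only: of_int_eq_iff)
  have 5: "Factorial_Ring.prime (5 :: int)"
    by simp
  have "p \<noteq> 0"
    using eq pq(1) by auto
  then have "2 * multiplicity 5 p = multiplicity 5 (5 * q\<^sup>2)"
    using prime_elem_multiplicity_power_distrib[of 5 p 2] 5 unfolding eq by simp
  also have "\<dots> = Suc (2 * multiplicity 5 q)"
    using prime_elem_multiplicity_mult_distrib[of 5 5 "q\<^sup>2"]
      prime_elem_multiplicity_power_distrib[of 5 q 2] 5 pq(1) by simp
  finally show False
    by presburger
qed

lemma fifth_root_golden:
  fixes w v :: complex
  assumes "w * v = 1" and "w ^ 5 = 1" and "w \<noteq> 1"
  shows "(w + v)\<^sup>2 + (w + v) = 1"
  using joukowski_factorization(8)[OF assms(1)] assms by auto

lemma tenth_root_joukowski: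
  fixes w v :: complex
  assumes "w * v = 1" and "w ^ 10 = 1"
  shows "w + v = 2 \<or> w + v = -2 \<or> (w + v)\<^sup>2 + (w + v) = 1 \<or> (w + v)\<^sup>2 - (w + v) = 1"
proof -
  have "(w ^ 5 - 1) * (w ^ 5 + 1) = w ^ 10 - 1"
    by (simp add: algebra_simps flip: power_add)
  then consider "w - 1 = 0" | "w + 1 = 0" | "(w + v)\<^sup>2 + (w + v) - 1 = 0" | "(w + v)\<^sup>2 - (w + v) - 1 = 0"
    using joukowski_factorization(8,9)[OF assms(1)] assms by auto
  then show ?thesis
    using joukowski_factorization(1,2)[OF assms(1)] assms(1) by cases (auto simp: add_eq_0_iff2)
qed

text \<open>Only the values 2, -2, -1 and 0 occur. This is the obstruction that excludes cycles of
  length 3 and 4.\<close>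

lemma third_or_fourth_root_joukowski_rational:
  fixes w v :: complex
  assumes "w * v = 1" and "w ^ 3 = 1 \<or> w ^ 4 = 1"
  shows "w + v \<in> \<rat>"
proof -
  have "(w - 1) * ((w + v) + 1) = 0 \<or> (w - 1) * (w + 1) * (w + v) = 0"
  proof -
    have "w\<^sup>2 - 1 = (w - 1) * (w + 1)"
      by (simp add: power2_eq_square algebra_simps)
    then show ?thesis
      using joukowski_factorization(3,5)[OF assms(1)] assms by auto
  qed
  then consider "w - 1 = 0" | "w + 1 = 0" | "w + v = 0" | "w + v = -1"
    by (auto simp: add_eq_0_iff2)
  then show ?thesis
    using joukowski_factorization(1,2)[OF assms(1)] assms(1)
    by cases (auto simp: add_eq_0_iff2 diff_eq_eq)
qed

text \<open>The quadratic \<open>X^2 - s X + p\<close> has both roots in \<open>[-2, 2]\<close>, so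
  \<open>s\<close> and \<open>p\<close> are bounded and finitely many quadratics remain.\<close>

lemma bounded_quadratic_integer_cases:
  fixes r r' :: real and s p :: int
  assumes "r + r' = of_int s" and "r * r' = of_int p" and "\<bar>r\<bar> \<le> 2" and "\<bar>r'\<bar> \<le> 2"
  shows "r \<in> {-2, -1, 0, 1, 2} \<or> r\<^sup>2 = 2 \<or> r\<^sup>2 = 3 \<or> r\<^sup>2 + r = 1 \<or> r\<^sup>2 - r = 1"
proof -
  \<comment> \<open>These products are the values of the quadratic at 2 and -2. With the
    discriminant bound below they cut down the 81 candidates for \<open>(s, p)\<close>.\<close>
  have "(2 - r) * (2 - r') \<ge> 0" "(2 + r) * (2 + r') \<ge> 0"
    using assms(3,4) by (auto intro!: mult_nonneg_nonneg)
  then have "of_int (4 - 2 * s + p) \<ge> (0::real)" "of_int (4 + 2 * s + p) \<ge> (0::real)"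
    using assms(1,2) by (simp_all add: algebra_simps)
  then have sp: "4 - 2 * s + p \<ge> 0" "4 + 2 * s + p \<ge> 0"
    by (simp_all only: of_int_0_le_iff)
  have "(r + r')\<^sup>2 - 4 * (r * r') = (r - r')\<^sup>2"
    by (simp add: power2_eq_square algebra_simps)
  then have "of_int (s\<^sup>2 - 4 * p) \<ge> (0::real)"
    using assms(1,2) by simp
  then have disc: "4 * p \<le> s\<^sup>2"
    by (simp only: of_int_0_le_iff)
  have "\<bar>real_of_int s\<bar> \<le> 4"
    using assms(1,3,4) by linarith
  then have "s \<in> {-4..4}"
    by auto
  then have s: "s \<in> {-4, -3, -2, -1, 0, 1, 2, 3, 4}"
    by auto
  have "\<bar>r * r'\<bar> \<le> 2 * 2"
    unfolding abs_mult using assms(3,4) by (intro mult_mono) auto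
  then have "p \<in> {-4..4}"
    using assms(2) by auto
  then have p: "p \<in> {-4, -3, -2, -1, 0, 1, 2, 3, 4}"
    by auto
  have eq: "r * r = of_int s * r - of_int p"
    by (simp add: algebra_simps flip: assms(1,2))
  have "(s, p) \<in> {(-4, 4), (-3, 2), (-2, 0), (-2, 1), (-1, -2), (-1, -1), (-1, 0), (0, -4), (0, -3), (0, -2),
      (0, -1), (0, 0), (1, -2), (1, -1), (1, 0), (2, 0), (2, 1), (3, 2), (4, 4)}"
    using s p sp disc by (elim insertE emptyE) simp_all
  \<comment> \<open>Fifteen of the nineteen pairs split over the integers in \<open>[-2, 2]\<close>;
    the other four are \<open>X^2 - 2\<close>, \<open>X^2 - 3\<close>, \<open>X^2 - X - 1\<close>
    and \<open>X^2 + X - 1\<close>.\<close>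
  then have "(\<exists>a\<in>{-2, -1, 0, 1, 2}. \<exists>b\<in>{-2, -1, 0, 1, 2}. s = a + b \<and> p = a * b) \<or>
      (s, p) \<in> {(0, -2), (0, -3), (1, -1), (-1, -1)}"
    by (elim insertE; simp)
  then show ?thesis
  proof
    assume "\<exists>a\<in>{-2, -1, 0, 1, 2}. \<exists>b\<in>{-2, -1, 0, 1, 2}. s = a + b \<and> p = a * b"
    then obtain a b where ab: "a \<in> {-2, -1, 0, 1, 2}" "b \<in> {-2, -1, 0, 1, 2}" "s = a + b" "p = a * b"
      by blast
    then have "(r - of_int a) * (r - of_int b) = 0"
      using eq by (simp add: algebra_simps)
    then have "r = of_int a \<or> r = of_int b"
      by simp
    then have "r \<in> real_of_int ` {-2, -1, 0, 1, 2}"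
      using ab(1,2) by blast
    then show ?thesis
      by simp
  next
    assume "(s, p) \<in> {(0, -2), (0, -3), (1, -1), (-1, -1)}"
    then show ?thesis
      using eq by (elim insertE) (simp_all add: power2_eq_square)
  qed
qed

text \<open>The number \<open>w + v\<close> is a root of the monic \<open>dickson n - 2\<close>, so
  its primitive minimal polynomial \<open>m\<close> has leading coefficient 1 or -1 and all roots of
  \<open>m\<close> are real in \<open>[-2, 2]\<close>. As \<open>m\<close> has degree at most two,
  the bounded case analysis applies.\<close>

lemma quadratic_root_of_unity_order:
  fixes w v :: complex and p :: "int poly"
  assumes "w ^ n = 1" and "n > 0" and wv: "w * v = 1"
    and "p \<noteq> 0" and "degree p \<le> 2" and "poly (of_int_poly p) (w + v) = 0"
  shows "w ^ 8 = 1 \<or> w ^ 10 = 1 \<or> w ^ 12 = 1"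
proof -
  let ?z = "w + v"
  let ?R = "\<lambda>p :: int poly. p \<noteq> 0 \<and> poly (of_int_poly p) ?z = 0"
  obtain m0 where m0: "?R m0" and min: "\<And>p. ?R p \<Longrightarrow> degree m0 \<le> degree p"
    using ex_has_least_nat[of ?R p degree] assms(4,6) by blast
  define m where "m = primitive_part m0"
  have m0_eq: "m0 = smult (content m0) m"
    by (simp add: m_def)
  have deg: "degree m = degree m0"
    by (simp add: m_def)
  have cont: "content m = 1"
    using m0 by (simp add: m_def)
  have "of_int (content m0) * poly (of_int_poly m) ?z = poly (of_int_poly (smult (content m0) m)) ?z"
    by (simp add: hom_distribs)
  then have root: "poly (of_int_poly m) ?z = 0"
    using m0 m0_eq by simp
  define g where "g = dickson n - [:2:]"
  have "degree g = n"
    using degree_dickson[of n] assms(2) unfolding g_def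
    by (metis degree_add_eq_left degree_minus degree_pCons_0 diff_conv_add_uminus)
  then have g: "lead_coeff g = 1"
    using degree_dickson[of n] lead_coeff_dickson[of n] assms(2) by (cases n) (auto simp: g_def)
  have "v ^ n = 1"
    using assms(1) wv by (metis mult_1 power_mult_distrib power_one)
  then have "poly (of_int_poly g) ?z = 0"
    using poly_dickson[OF wv, of n] assms(1) by (simp add: g_def hom_distribs)
  then obtain k q where kq: "smult k g = m * q" "k \<noteq> 0" and lc: "lead_coeff m dvd 1"
    using lead_coeff_dvd_one_if_minimal[OF cont root _ g] min deg by metis
  \<comment> \<open>A root of \<open>m\<close> is a root of \<open>g\<close>, because
    \<open>m\<close> divides a nonzero multiple of \<open>g\<close>.\<close>
  have conj: "\<exists>r. z = of_real r \<and> \<bar>r\<bar> \<le> 2" if "poly (of_int_poly m) z = 0" for z :: complex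
  proof -
    have "poly (of_int_poly (smult k g)) z = 0"
      using that unfolding kq(1) by (simp add: hom_distribs)
    then have "poly (of_int_poly g) z = 0"
      using kq(2) by (simp add: hom_distribs)
    then have "poly (of_int_poly (dickson n)) z = 2"
      by (simp add: g_def hom_distribs)
    then show ?thesis
      using dickson_eq_two assms(2) by metis
  qed
  obtain r where r: "?z = of_real r" "\<bar>r\<bar> \<le> 2"
    using conj[OF root] by blast
  define a where "a = lead_coeff m"
  have a: "a = 1 \<or> a = -1"
    using lc unfolding a_def by auto
  have "degree m \<le> 2"
    using min[of p] assms(4-6) deg by simp
  then have m_eq: "m = [:coeff m 0, coeff m 1, coeff m 2:]"
    by (intro poly_eqI) (auto simp: coeff_pCons coeff_eq_0 numeral_2_eq_2 split: nat.split)
  have root_iff: "poly (of_int_poly m) z = of_int (coeff m 0) + of_int (coeff m 1) * z + of_int (coeff m 2) * z\<^sup>2"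
    for z :: complex
    by (subst m_eq) (simp add: hom_distribs power2_eq_square algebra_simps)
  have "\<exists>s p r'. r + r' = of_int s \<and> r * r' = of_int p \<and> \<bar>r'\<bar> \<le> 2"
  proof -
    consider "degree m = 0" | "degree m = 1" | "degree m = 2"
      using \<open>degree m \<le> 2\<close> by linarith
    then show ?thesis
    proof cases
      case 1
      then obtain c where "m = [:c:]"
        by (metis degree_eq_zeroE)
      then show ?thesis
        using root cont by simp
    next
      case 2
      define c where "c = coeff m 0"
      have "coeff m 1 = a" "coeff m 2 = 0"
        using 2 by (simp_all add: a_def coeff_eq_0)
      then have "of_real (c + a * r) = (0 :: complex)"
        using root unfolding root_iff r(1) by (simp add: c_def)
      then have "c + a * r = 0"
        by (simp only: of_real_eq_0_iff)
      then have "r = of_int (- a * c)"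
        using a by auto
      then show ?thesis
        \<comment> \<open>A rational conjugate-free root is padded with 0 as second root, so that
          the quadratic case list covers it as well.\<close>
        by (intro exI[of _ "- a * c"] exI[of _ 0] exI[of _ "0::real"]) simp
    next
      case 3
      define b c where "b = coeff m 1" and "c = coeff m 0"
      have root_iff: "poly (of_int_poly m) z = of_int c + of_int b * z + of_int a * z\<^sup>2" for z :: complex
        unfolding root_iff using 3 by (simp add: a_def b_def c_def)
      \<comment> \<open>By Vieta the second root is \<open>- b / a - z\<close>. Since
        \<open>a\<close> is 1 or -1, division by \<open>a\<close> is multiplication by
        \<open>a\<close>, and sum and product of the roots are integers.\<close>
      have "poly (of_int_poly m) (- of_int (a * b) - ?z) = poly (of_int_poly m) ?z"
        using a unfolding root_iff by (auto simp: power2_eq_square algebra_simps)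
      then obtain r' where r': "- of_int (a * b) - ?z = of_real r'" "\<bar>r'\<bar> \<le> 2"
        using conj root by metis
      have sum: "r + r' = of_int (- a * b)"
      proof -
        have "of_real (r + r') = (of_int (- a * b) :: complex)"
          unfolding of_real_add r'(1)[symmetric] r(1)[symmetric] by simp
        then show ?thesis
          by (metis of_real_eq_iff of_real_of_int_eq)
      qed
      have "of_real (c + b * r + a * r\<^sup>2) = (0 :: complex)"
        using root unfolding root_iff r(1) by simp
      then have "c + b * r + a * r\<^sup>2 = 0"
        by (simp only: of_real_eq_0_iff)
      then have "r * (- (a * b) - r) = of_int (a * c)"
        using a by (elim disjE; simp add: power2_eq_square algebra_simps; linarith)
      moreover have "r' = - (a * b) - r"
        using sum by simp
      ultimately have "r * r' = of_int (a * c)"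
        by simp
      then show ?thesis
        using sum r'(2) by (intro exI[of _ "- a * b"] exI[of _ "a * c"] exI[of _ r']) simp
    qed
  qed
  then obtain s p r' where srp: "r + r' = of_int s" "r * r' = of_int p" "\<bar>r'\<bar> \<le> 2"
    by (elim exE conjE) metis
  have "?z\<^sup>2 = of_real (r\<^sup>2)" "?z\<^sup>2 + ?z = of_real (r\<^sup>2 + r)" "?z\<^sup>2 - ?z = of_real (r\<^sup>2 - r)"
    by (simp_all add: r(1))
  then have "r\<^sup>2 = 2 \<Longrightarrow> ?z\<^sup>2 = 2" "r\<^sup>2 = 3 \<Longrightarrow> ?z\<^sup>2 = 3" "r\<^sup>2 + r = 1 \<Longrightarrow> ?z\<^sup>2 + ?z = 1"
    "r\<^sup>2 - r = 1 \<Longrightarrow> ?z\<^sup>2 - ?z = 1"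
    by simp_all
  moreover have "r \<in> {-2, -1, 0, 1, 2} \<Longrightarrow> \<exists>e\<in>{-2, -1, 0, 1, 2}. ?z = e"
    unfolding r(1) by auto
  ultimately show ?thesis
    using bounded_quadratic_integer_cases[OF srp(1,2) r(2) srp(3)]
    by (intro joukowski_root_of_unity[OF wv]) blast
qed

section \<open>Quadratic splitting fields\<close>

lemma complex_field: "field (ring_of_type_algebra :: complex ring)"
  by (rule field_from_type_algebra)

lemma Collect_nested_image:
  "{f k x | k x. k \<in> K \<and> x \<in> {g l | l. l \<in> L}} = {f k (g l) | k l. k \<in> K \<and> l \<in> L}"
  by blast

text \<open>The inductive notion \<open>dimension\<close> adds one basis vector at a time, starting
  from \<open>{0}\<close>; unfolding two steps yields the vectors \<open>u\<close> and
  \<open>v\<close>.\<close>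

lemma dimension_two_complex_iff:
  "ring.dimension (ring_of_type_algebra :: complex ring) 2 K E \<longleftrightarrow>
    (\<exists>u v. u \<noteq> 0 \<and> (\<forall>k\<in>K. v \<noteq> k * u) \<and> E = {k * v + l * u | k l. k \<in> K \<and> l \<in> K})"
proof -
  interpret C: field "ring_of_type_algebra :: complex ring"
    by (rule complex_field)
  have ext: "C.line_extension K a F = {k * a + x | k x. k \<in> K \<and> x \<in> F}" for a F
    by (auto simp: C.line_extension_mem_iff) (auto simp: ring_of_type_algebra_def)
  have "C.dimension 0 K F \<longleftrightarrow> F = {0}" for F
    by (subst C.dimension.simps) (simp add: ring_of_type_algebra_def)
  moreover have S: "C.dimension (Suc n) K F \<longleftrightarrow>
      (\<exists>a F'. a \<notin> F' \<and> C.dimension n K F' \<and> F = C.line_extension K a F')" for n F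
    by (subst C.dimension.simps) (auto simp: ring_of_type_algebra_def)
  ultimately have 1: "C.dimension (Suc 0) K F \<longleftrightarrow> (\<exists>u. u \<noteq> 0 \<and> F = {l * u | l. l \<in> K})" for F
    unfolding ext by auto
  have two: "C.dimension 2 K E \<longleftrightarrow> (\<exists>a F. a \<notin> F \<and> (\<exists>u. u \<noteq> 0 \<and> F = {l * u | l. l \<in> K}) \<and>
      E = {k * a + x | k x. k \<in> K \<and> x \<in> F})"
    unfolding numeral_2_eq_2 S[of "Suc 0"] 1 unfolding ext ..
  have eq: "{k * v + x | k x. k \<in> K \<and> x \<in> {l * u | l. l \<in> K}} = {k * v + l * u | k l. k \<in> K \<and> l \<in> K}" for u v
    by (rule Collect_nested_image)
  show ?thesis
  proof
    assume "C.dimension 2 K E"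
    then have "\<exists>a u. a \<notin> {l * u | l. l \<in> K} \<and> u \<noteq> 0 \<and> E = {k * a + l * u | k l. k \<in> K \<and> l \<in> K}"
      unfolding two by (elim exE conjE, unfold eq[symmetric]) iprover
    then obtain u v where uv: "u \<noteq> 0" "E = {k * v + l * u | k l. k \<in> K \<and> l \<in> K}" "v \<notin> {l * u | l. l \<in> K}"
      by iprover
    have "\<forall>k\<in>K. v \<noteq> k * u"
      using uv(3) by blast
    then show "\<exists>u v. u \<noteq> 0 \<and> (\<forall>k\<in>K. v \<noteq> k * u) \<and> E = {k * v + l * u | k l. k \<in> K \<and> l \<in> K}"
      using uv(1,2) by (intro exI[of _ u] exI[of _ v] conjI)
  next
    assume "\<exists>u v. u \<noteq> 0 \<and> (\<forall>k\<in>K. v \<noteq> k * u) \<and> E = {k * v + l * u | k l. k \<in> K \<and> l \<in> K}"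
    then obtain u v where uv: "u \<noteq> 0" "\<forall>k\<in>K. v \<noteq> k * u" "E = {k * v + l * u | k l. k \<in> K \<and> l \<in> K}"
      by iprover
    have "v \<notin> {l * u | l. l \<in> K}"
      using uv(2) by blast
    then show "C.dimension 2 K E"
      unfolding two using uv(1,3) by (intro exI[of _ v] exI[of _ "{l * u | l. l \<in> K}"] conjI exI[of _ u] refl, unfold eq)
  qed
qed

lemma generate_field_complex_simps:
  fixes h :: complex
  shows "\<one>\<^bsub>ring_of_type_algebra\<^esub> = (1 :: complex)" "\<zero>\<^bsub>ring_of_type_algebra\<^esub> = (0 :: complex)"
    "h \<oplus>\<^bsub>ring_of_type_algebra\<^esub> h' = h + h'" "h \<otimes>\<^bsub>ring_of_type_algebra\<^esub> h' = h * h'"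
    "\<ominus>\<^bsub>ring_of_type_algebra\<^esub> h = - h"
    "h \<noteq> 0 \<Longrightarrow> inv\<^bsub>ring_of_type_algebra\<^esub> h = inverse h"
proof -
  interpret C: field "ring_of_type_algebra :: complex ring"
    by (rule complex_field)
  show simps: "\<one>\<^bsub>ring_of_type_algebra\<^esub> = (1 :: complex)" "\<zero>\<^bsub>ring_of_type_algebra\<^esub> = (0 :: complex)"
    "h \<oplus>\<^bsub>ring_of_type_algebra\<^esub> h' = h + h'" "h \<otimes>\<^bsub>ring_of_type_algebra\<^esub> h' = h * h'" for h h' :: complex
    by (simp_all add: ring_of_type_algebra_def)
  have carrier: "x \<in> carrier ring_of_type_algebra" for x :: complex
    by (simp add: ring_of_type_algebra_def)
  show "\<ominus>\<^bsub>ring_of_type_algebra\<^esub> h = - h"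
    by (rule C.minus_equality[OF _ carrier carrier]) (simp add: simps)
  show "inv\<^bsub>ring_of_type_algebra\<^esub> h = inverse h" if "h \<noteq> 0"
    by (rule C.comm_inv_char[OF carrier carrier]) (simp add: simps that)
qed

lemma generate_field_complex_subset:
  fixes E :: "complex set"
  assumes "H \<subseteq> E" and "1 \<in> E" and "\<And>x. x \<in> E \<Longrightarrow> - x \<in> E"
    and "\<And>x. x \<in> E \<Longrightarrow> x \<noteq> 0 \<Longrightarrow> inverse x \<in> E"
    and "\<And>x y. x \<in> E \<Longrightarrow> y \<in> E \<Longrightarrow> x + y \<in> E" and "\<And>x y. x \<in> E \<Longrightarrow> y \<in> E \<Longrightarrow> x * y \<in> E"
  shows "generate_field ring_of_type_algebra H \<subseteq> E"
proof
  fix x assume "x \<in> generate_field ring_of_type_algebra H"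
  then show "x \<in> E"
  proof induction
    case (m_inv h)
    then have "h \<noteq> 0"
      by (simp add: generate_field_complex_simps)
    then show ?case
      using m_inv assms(4) by (simp add: generate_field_complex_simps(6))
  qed (use assms in \<open>auto simp: generate_field_complex_simps\<close>)
qed

lemma splitting_field_closed:
  shows "x \<in> \<rat> \<Longrightarrow> x \<in> splitting_field \<Gamma>"
    and "x \<in> graph_eigenvalues \<Gamma> \<Longrightarrow> x \<in> splitting_field \<Gamma>"
    and "x \<in> splitting_field \<Gamma> \<Longrightarrow> y \<in> splitting_field \<Gamma> \<Longrightarrow> x + y \<in> splitting_field \<Gamma>"
    and "x \<in> splitting_field \<Gamma> \<Longrightarrow> y \<in> splitting_field \<Gamma> \<Longrightarrow> x * y \<in> splitting_field \<Gamma>"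
  unfolding splitting_field_def
  using generate_field.eng_add[of x ring_of_type_algebra _ y]
    generate_field.eng_mult[of x ring_of_type_algebra _ y]
  by (auto simp: generate_field_complex_simps intro: generate_field.incl)

text \<open>With rational eigenvalues only, the splitting field would lie in the rationals, and two
  rational basis vectors are proportional.\<close>

lemma two_integral_imp_irrational_eigenvalue:
  assumes "two_integral \<Gamma>"
  obtains x where "x \<in> graph_eigenvalues \<Gamma>" and "x \<notin> \<rat>"
proof (rule ccontr)
  assume "\<not> thesis"
  then have "graph_eigenvalues \<Gamma> \<subseteq> \<rat>"
    using that by blast
  then have "splitting_field \<Gamma> \<subseteq> \<rat>"
    unfolding splitting_field_def by (intro generate_field_complex_subset) auto
  moreover obtain u v where uv: "u \<noteq> 0" "\<forall>k\<in>\<rat>. v \<noteq> k * u"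
      "splitting_field \<Gamma> = {k * v + l * u | k l. k \<in> \<rat> \<and> l \<in> \<rat>}"
    using assms unfolding two_integral_def dimension_two_complex_iff by blast
  have "0 * v + 1 * u \<in> splitting_field \<Gamma>" "1 * v + 0 * u \<in> splitting_field \<Gamma>"
    unfolding uv(3) by (blast intro: Rats_0 Rats_1)+
  ultimately have "v / u \<in> \<rat>"
    by (intro Rats_divide) auto
  then have "v \<noteq> v / u * u"
    using uv(2) by blast
  then show False
    using uv(1) by simp
qed

text \<open>Clearing the three denominators keeps the relation nontrivial.\<close>

lemma rational_quadratic_imp_int_poly:
  fixes x :: complex
  assumes "a \<in> \<rat>" and "b \<in> \<rat>" and "c \<in> \<rat>" and "\<not> (a = 0 \<and> b = 0 \<and> c = 0)" and "a + b * x + c * x\<^sup>2 = 0"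
  obtains p :: "int poly" where "p \<noteq> 0" and "degree p \<le> 2" and "poly (of_int_poly p) x = 0"
proof -
  obtain a1 a2 where a: "a2 > 0" "a = of_int a1 / of_int a2"
    using assms(1) by (metis Rats_cases')
  obtain b1 b2 where b: "b2 > 0" "b = of_int b1 / of_int b2"
    using assms(2) by (metis Rats_cases')
  obtain c1 c2 where c: "c2 > 0" "c = of_int c1 / of_int c2"
    using assms(3) by (metis Rats_cases')
  define p where "p = [:a1 * b2 * c2, b1 * a2 * c2, c1 * a2 * b2:]"
  have "of_int a1 = a * of_int a2" "of_int b1 = b * of_int b2" "of_int c1 = c * of_int c2"
    using a b c by simp_all
  then have "poly (of_int_poly p) x = of_int (a2 * b2 * c2) * (a + b * x + c * x\<^sup>2)"
    by (simp add: p_def hom_distribs algebra_simps power2_eq_square)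
  then have "poly (of_int_poly p) x = 0"
    using assms(5) by simp
  moreover have "p \<noteq> 0"
    using a b c assms(4) by (auto simp: p_def)
  moreover have "degree p \<le> 2"
    by (simp add: p_def)
  ultimately show ?thesis
    using that by blast
qed

text \<open>The numbers \<open>1\<close>, \<open>x\<close> and \<open>x^2\<close> lie in a space of
  dimension two and are therefore linearly dependent over the rationals.\<close>

lemma two_integral_eigenvalue_quadratic:
  assumes "two_integral \<Gamma>" and "x \<in> graph_eigenvalues \<Gamma>"
  obtains p :: "int poly" where "p \<noteq> 0" and "degree p \<le> 2" and "poly (of_int_poly p) x = 0"
proof -
  let ?E = "splitting_field \<Gamma>"
  obtain u v where E: "?E = {k * v + l * u | k l. k \<in> \<rat> \<and> l \<in> \<rat>}"
    using assms(1) unfolding two_integral_def dimension_two_complex_iff by blast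
  have "1 \<in> ?E" and x: "x \<in> ?E"
    using assms(2) by (simp_all add: splitting_field_closed(1,2))
  moreover have "x\<^sup>2 \<in> ?E"
    unfolding power2_eq_square using x x by (rule splitting_field_closed(4))
  ultimately obtain k0 l0 k1 l1 k2 l2 where rat: "k0 \<in> \<rat>" "l0 \<in> \<rat>" "k1 \<in> \<rat>" "l1 \<in> \<rat>" "k2 \<in> \<rat>" "l2 \<in> \<rat>"
    and eq: "1 = k0 * v + l0 * u" "x = k1 * v + l1 * u" "x\<^sup>2 = k2 * v + l2 * u"
    unfolding E by blast
  show ?thesis
  \<comment> \<open>The determinant of the coordinates of \<open>1\<close> and \<open>x\<close>
    decides. If it vanishes, these two are already dependent; otherwise the 2 by 2 minors of the
    three coordinate vectors are the coefficients of a relation.\<close>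
  proof (cases "k0 * l1 = k1 * l0")
    case True
    have "k0 * x = k1 * (k0 * v + l0 * u)" "l0 * x = l1 * (k0 * v + l0 * u)"
      unfolding eq(2) using True by (simp_all add: algebra_simps)
    then have "- k1 + k0 * x + 0 * x\<^sup>2 = 0" "- l1 + l0 * x + 0 * x\<^sup>2 = 0"
      by (simp_all flip: eq(1))
    moreover have "k0 \<noteq> 0 \<or> l0 \<noteq> 0"
      using eq(1) by auto
    ultimately show ?thesis
      using rational_quadratic_imp_int_poly[of "- k1" k0 0 x] rational_quadratic_imp_int_poly[of "- l1" l0 0 x]
        rat that by (metis Rats_0 Rats_minus_iff)
  next
    case False
    have "(k1 * l2 - k2 * l1) * (k0 * v + l0 * u) + (k2 * l0 - k0 * l2) * (k1 * v + l1 * u) +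
        (k0 * l1 - k1 * l0) * (k2 * v + l2 * u) = 0"
      by (simp add: algebra_simps)
    then have "(k1 * l2 - k2 * l1) + (k2 * l0 - k0 * l2) * x + (k0 * l1 - k1 * l0) * x\<^sup>2 = 0"
      unfolding eq(1)[symmetric] eq(2)[symmetric] eq(3)[symmetric] by simp
    then show ?thesis
      using False rational_quadratic_imp_int_poly[of "k1 * l2 - k2 * l1" "k2 * l0 - k0 * l2" "k0 * l1 - k1 * l0" x]
        rat that by (metis Rats_diff Rats_mult eq_iff_diff_eq_0)
  qed
qed

text \<open>The numbers \<open>k * s + l\<close> form a field containing all eigenvalues, and
  conversely the irrational eigenvalue \<open>x\<close> generates \<open>s\<close>.\<close>

lemma two_integral_if_golden:
  assumes "s\<^sup>2 = 5" and "s \<notin> \<rat>"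
    and "graph_eigenvalues \<Gamma> \<subseteq> {k * s + l | k l. k \<in> \<rat> \<and> l \<in> \<rat>}"
    and "x \<in> graph_eigenvalues \<Gamma>" and "x \<notin> \<rat>"
  shows "two_integral \<Gamma>"
proof -
  define E where "E = {k * s + l * 1 | k l. k \<in> \<rat> \<and> l \<in> \<rat>}"
  have EI: "k * s + l \<in> E" if "k \<in> \<rat>" "l \<in> \<rat>" for k l
    unfolding E_def using that by auto
  have sub: "splitting_field \<Gamma> \<subseteq> E"
    unfolding splitting_field_def
  proof (rule generate_field_complex_subset)
    show "\<rat> \<union> graph_eigenvalues \<Gamma> \<subseteq> E"
      using EI[of 0] assms(3) by (auto simp: E_def)
    show "1 \<in> E"
      using EI[of 0 1] by simp
    fix a assume "a \<in> E"
    then obtain k l where a: "k \<in> \<rat>" "l \<in> \<rat>" "a = k * s + l"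
      by (auto simp: E_def)
    have "(- k) * s + (- l) \<in> E"
      using a by (intro EI) auto
    then show "- a \<in> E"
      by (simp add: a(3))
    {
      assume "a \<noteq> 0"
      \<comment> \<open>The conjugate of \<open>a\<close> is nonzero because \<open>s\<close> is
        irrational; hence the norm \<open>l^2 - 5 k^2\<close> is a nonzero rational and gives the
        inverse of \<open>a\<close>.\<close>
      have "l - k * s \<noteq> 0"
      proof
        assume 0: "l - k * s = 0"
        then have "k \<noteq> 0"
          using \<open>a \<noteq> 0\<close> a(3) by auto
        then have "s = l / k"
          using 0 by (simp add: field_simps)
        then show False
          using a assms(2) by auto
      qed
      have norm: "a * (l - k * s) = l\<^sup>2 - 5 * k\<^sup>2"
        unfolding a(3) assms(1)[symmetric] by (simp add: algebra_simps power2_eq_square)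
      define N where "N = l\<^sup>2 - 5 * k\<^sup>2"
      have "N \<noteq> 0" "N \<in> \<rat>"
        using norm \<open>a \<noteq> 0\<close> \<open>l - k * s \<noteq> 0\<close> a(1,2) by (auto simp: N_def)
      have "a * ((- k / N) * s + l / N) = 1"
        using norm \<open>N \<noteq> 0\<close> by (simp add: N_def[symmetric] field_simps)
      then have "inverse a = (- k / N) * s + l / N"
        by (rule inverse_unique)
      then show "inverse a \<in> E"
        using EI[of "- k / N" "l / N"] \<open>N \<in> \<rat>\<close> a by auto
    }
    fix b assume "b \<in> E"
    then obtain k' l' where b: "k' \<in> \<rat>" "l' \<in> \<rat>" "b = k' * s + l'"
      by (auto simp: E_def)
    have "(k + k') * s + (l + l') \<in> E" "(k * l' + k' * l) * s + (5 * k * k' + l * l') \<in> E"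
      using a b by (auto intro!: EI)
    moreover have "a + b = (k + k') * s + (l + l')"
      by (simp add: a(3) b(3) algebra_simps)
    moreover have "a * b = (k * l' + k' * l) * s + (s\<^sup>2 * k * k' + l * l')"
      by (simp add: a(3) b(3) algebra_simps power2_eq_square)
    then have "a * b = (k * l' + k' * l) * s + (5 * k * k' + l * l')"
      unfolding assms(1) .
    ultimately show "a + b \<in> E" "a * b \<in> E"
      by simp_all
  qed
  obtain k l where x: "k \<in> \<rat>" "l \<in> \<rat>" "x = k * s + l"
    using assms(3,4) by auto
  have "k \<noteq> 0"
    using x assms(5) by auto
  then have s: "s = (1 / k) * x + (- l / k)"
    unfolding x(3) by (simp add: add_divide_distrib distrib_left)
  have "(1 / k) * x + (- l / k) \<in> splitting_field \<Gamma>"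
    using x(1,2) assms(4) by (intro splitting_field_closed(3,4)) (simp_all add: splitting_field_closed(1,2))
  then have s_in: "s \<in> splitting_field \<Gamma>"
    unfolding s[symmetric] .
  have "E \<subseteq> splitting_field \<Gamma>"
  proof
    fix y assume "y \<in> E"
    then obtain k l where "k \<in> \<rat>" "l \<in> \<rat>" "y = k * s + l"
      by (auto simp: E_def)
    then show "y \<in> splitting_field \<Gamma>"
      using s_in by (simp add: splitting_field_closed)
  qed
  then have "splitting_field \<Gamma> = E"
    using sub by (rule subset_antisym[rotated])
  moreover have "\<forall>k\<in>\<rat>. s \<noteq> k * 1"
    using assms(2) by force
  ultimately have "(1 :: complex) \<noteq> 0 \<and> (\<forall>k\<in>\<rat>. s \<noteq> k * 1) \<and>
      splitting_field \<Gamma> = {k * s + l * 1 | k l. k \<in> \<rat> \<and> l \<in> \<rat>}"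
    unfolding E_def by simp
  then show ?thesis
    unfolding two_integral_def dimension_two_complex_iff by - (rule exI[of _ 1], rule exI[of _ s])
qed

section \<open>Eigenvalues of Cayley graphs of valency two\<close>

lemma sum_cayley_neighbours:
  fixes G (structure) and f :: "'a \<Rightarrow> complex"
  assumes "group G" and "finite (carrier G)" and "S \<subseteq> carrier G" and "g \<in> carrier G"
  shows "(\<Sum>h\<in>carrier G. (if (g, h) \<in> parcs (cayley_graph G S) then 1 else 0) * f h) = (\<Sum>s\<in>S. f (s \<otimes> g))"
proof -
  interpret group G by fact
  let ?N = "{h \<in> carrier G. h \<otimes> inv g \<in> S}"
  have "(\<Sum>h\<in>carrier G. (if (g, h) \<in> parcs (cayley_graph G S) then 1 else 0) * f h) =
      (\<Sum>h\<in>carrier G. if h \<otimes> inv g \<in> S then f h else 0)"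
    using assms(4) by (intro sum.cong) (auto simp: cayley_graph_def)
  also have "\<dots> = sum f ?N"
    using assms(2) by (simp add: sum.inter_filter)
  also have "\<dots> = (\<Sum>s\<in>S. f (s \<otimes> g))"
    using assms(3,4)
    by (intro sum.reindex_bij_witness[of _ "\<lambda>s. s \<otimes> g" "\<lambda>h. h \<otimes> inv g"])
      (auto simp: m_assoc subsetD)
  finally show ?thesis .
qed

text \<open>Eigenvectors are read as functions on the group, which removes the enumeration
  \<open>vs\<close>: the neighbours of \<open>g\<close> are the products
  \<open>s \<otimes> g\<close> with \<open>s\<close> in \<open>S\<close>.\<close>

lemma graph_eigenvalues_cayley_iff:
  fixes G (structure)
  assumes "group G" and "finite (carrier G)" and "S \<subseteq> carrier G"
  shows "x \<in> graph_eigenvalues (cayley_graph G S) \<longleftrightarrow>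
    (\<exists>f. (\<exists>g\<in>carrier G. f g \<noteq> 0) \<and> (\<forall>g\<in>carrier G. (\<Sum>s\<in>S. f (s \<otimes> g)) = x * f g))"
proof -
  have row: "(adjacency_matrix (cayley_graph G S) vs *\<^sub>v v) $ i = (\<Sum>s\<in>S. f (s \<otimes> (vs ! i)))"
    if vs: "distinct vs" "set vs = carrier G" and i: "i < length vs" and v: "v \<in> carrier_vec (length vs)"
      and f: "\<And>j. j < length vs \<Longrightarrow> f (vs ! j) = v $ j"
    for vs and v :: "complex vec" and i f
  proof -
    have "(adjacency_matrix (cayley_graph G S) vs *\<^sub>v v) $ i =
        (\<Sum>j\<in>{..<length vs}. (if (vs ! i, vs ! j) \<in> parcs (cayley_graph G S) then 1 else 0) * f (vs ! j))"
      using i v f by (simp add: adjacency_matrix_def scalar_prod_def atLeast0LessThan)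
    also have "\<dots> = (\<Sum>h\<in>carrier G. (if (vs ! i, h) \<in> parcs (cayley_graph G S) then 1 else 0) * f h)"
      using bij_betw_nth[OF vs(1) refl vs(2)[symmetric]] by (rule sum.reindex_bij_betw)
    also have "\<dots> = (\<Sum>s\<in>S. f (s \<otimes> (vs ! i)))"
      using vs i nth_mem by (intro sum_cayley_neighbours assms) auto
    finally show ?thesis .
  qed
  show ?thesis
  proof
    assume "x \<in> graph_eigenvalues (cayley_graph G S)"
    then obtain vs and v :: "complex vec" where vs: "distinct vs" "set vs = carrier G"
      and ev: "eigenvector (adjacency_matrix (cayley_graph G S) vs) v x"
      by (auto simp: graph_eigenvalues_def eigenvalue_def cayley_graph_def)
    have v: "v \<in> carrier_vec (length vs)" "v \<noteq> 0\<^sub>v (length vs)"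
      and eq: "adjacency_matrix (cayley_graph G S) vs *\<^sub>v v = x \<cdot>\<^sub>v v"
      using ev by (auto simp: eigenvector_def adjacency_matrix_def)
    \<comment> \<open>The vector is transported along the inverse of the enumeration; only the
      values of \<open>f\<close> on the carrier matter.\<close>
    define f where "f h = v $ the_inv_into {..<length vs} ((!) vs) h" for h
    have f: "f (vs ! j) = v $ j" if "j < length vs" for j
    proof -
      have "inj_on ((!) vs) {..<length vs}"
        using vs(1) by (intro inj_on_nth) auto
      then have "the_inv_into {..<length vs} ((!) vs) (vs ! j) = j"
        using that by (intro the_inv_into_f_f) auto
      then show ?thesis
        by (simp only: f_def)
    qed
    have "(\<Sum>s\<in>S. f (s \<otimes> g)) = x * f g" if g: "g \<in> carrier G" for g
    proof -
      obtain i where i: "i < length vs" "g = vs ! i"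
        using g unfolding vs(2)[symmetric] in_set_conv_nth by blast
      then show ?thesis
        using row[OF vs i(1) v(1) f] f[OF i(1)] v(1) unfolding eq by simp
    qed
    moreover have "\<exists>g\<in>carrier G. f g \<noteq> 0"
    proof (rule ccontr)
      assume "\<not> (\<exists>g\<in>carrier G. f g \<noteq> 0)"
      then have "v $ j = 0" if "j < length vs" for j
        using f[OF that] that vs(2) nth_mem by metis
      then have "v = 0\<^sub>v (length vs)"
        using v(1) by (intro eq_vecI) auto
      then show False
        using v(2) by simp
    qed
    ultimately show "\<exists>f. (\<exists>g\<in>carrier G. f g \<noteq> 0) \<and> (\<forall>g\<in>carrier G. (\<Sum>s\<in>S. f (s \<otimes> g)) = x * f g)"
      by blast
  next
    assume "\<exists>f. (\<exists>g\<in>carrier G. f g \<noteq> 0) \<and> (\<forall>g\<in>carrier G. (\<Sum>s\<in>S. f (s \<otimes> g)) = x * f g)"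
    then obtain f g where g: "g \<in> carrier G" "f g \<noteq> 0"
      and f: "\<And>g. g \<in> carrier G \<Longrightarrow> (\<Sum>s\<in>S. f (s \<otimes> g)) = x * f g"
      by blast
    obtain vs where vs: "set vs = carrier G" "distinct vs"
      using finite_distinct_list[OF assms(2)] by blast
    define v where "v = vec (length vs) (\<lambda>j. f (vs ! j))"
    have v: "v \<in> carrier_vec (length vs)"
      by (simp add: v_def)
    obtain i where "i < length vs" "g = vs ! i"
      using g(1) unfolding vs(1)[symmetric] in_set_conv_nth by blast
    then have "v $ i \<noteq> 0\<^sub>v (length vs) $ i"
      using g(2) by (simp add: v_def)
    then have "v \<noteq> 0\<^sub>v (length vs)"
      by metis
    moreover have "adjacency_matrix (cayley_graph G S) vs *\<^sub>v v = x \<cdot>\<^sub>v v"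
    proof (rule eq_vecI)
      show "(adjacency_matrix (cayley_graph G S) vs *\<^sub>v v) $ j = (x \<cdot>\<^sub>v v) $ j"
        if "j < dim_vec (x \<cdot>\<^sub>v v)" for j
        using that row[OF vs(2,1) _ v, of j f] f[of "vs ! j"] vs(1) nth_mem[of j vs] by (simp add: v_def)
    qed (simp_all add: v_def adjacency_matrix_def)
    ultimately have "eigenvector (adjacency_matrix (cayley_graph G S) vs) v x"
      using v by (simp add: eigenvector_def adjacency_matrix_def)
    then show "x \<in> graph_eigenvalues (cayley_graph G S)"
      using vs by (auto simp: graph_eigenvalues_def eigenvalue_def cayley_graph_def)
  qed
qed

text \<open>The characteristic polynomial is \<open>(X - w) (X - v)\<close>, so
  \<open>b k = a (k + 1) - w * a k\<close> is geometric with ratio \<open>v\<close>. Periodicity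
  gives \<open>v ^ n = 1\<close> or \<open>b = 0\<close>; in the latter case \<open>a\<close> itself
  is geometric with ratio \<open>w\<close>, and \<open>a 0 \<noteq> 0\<close> gives
  \<open>w ^ n = 1\<close>.\<close>

lemma periodic_recurrence_root:
  fixes a :: "nat \<Rightarrow> complex"
  assumes "\<And>k. a (Suc (Suc k)) = x * a (Suc k) - a k"
    and "a n = a 0" and "a (Suc n) = a (Suc 0)" and "a 0 \<noteq> 0"
  obtains w v where "w * v = 1" and "x = w + v" and "w ^ n = 1"
proof -
  obtain w v where wv: "w * v = 1" and x: "x = w + v"
    by (rule exists_joukowski_preimage)
  define b where "b k = a (Suc k) - w * a k" for k
  have b_Suc: "b (Suc k) = v * b k" for k
    unfolding b_def assms(1) x using wv by (simp add: algebra_simps)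
  have b: "b k = v ^ k * b 0" for k
    by (induction k) (simp_all add: b_Suc)
  have "b n = b 0"
    by (simp add: b_def assms(2,3))
  then have "v ^ n = 1 \<or> b 0 = 0"
    using b[of n] by auto
  moreover have "w ^ n = 1" if "v ^ n = 1"
    using that wv by (metis mult_1_right power_mult_distrib power_one)
  moreover have "w ^ n = 1" if "b 0 = 0"
  proof -
    have "a (Suc k) = w * a k" for k
      using b[of k] that by (simp add: b_def)
    then have "a k = w ^ k * a 0" for k
      by (induction k) simp_all
    from this[of n] show ?thesis
      using assms(2,4) by simp
  qed
  ultimately show ?thesis
    using that wv x by blast
qed

lemma doubleton_sum:
  fixes f :: "'a \<Rightarrow> complex"
  assumes "{a, b} = {c, d}"
  shows "f a + f b = f c + f d"
  using assms by (auto simp: doubleton_eq_iff)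

text \<open>A closed walk in which \<open>h k\<close> and \<open>h (k + 2)\<close> are the two neighbours of \<open>h (k + 1)\<close> treats the
  two kinds of connection sets alike: powers of \<open>x\<close> for an inverse pair, alternating words for two
  involutions.\<close>

definition cayley_walk :: "('a, 'b) monoid_scheme \<Rightarrow> 'a \<Rightarrow> 'a \<Rightarrow> (nat \<Rightarrow> 'a) \<Rightarrow> bool" where
  "cayley_walk G s t h \<longleftrightarrow> (\<forall>k. h k \<in> carrier G \<and>
     {h k, h (Suc (Suc k))} = {s \<otimes>\<^bsub>G\<^esub> h (Suc k), t \<otimes>\<^bsub>G\<^esub> h (Suc k)})"

text \<open>Along a closed walk starting where the eigenfunction does not vanish, its values satisfy
  the recurrence of \<open>periodic_recurrence_root\<close>.\<close>

lemma cayley_eigenvalue_imp_root_of_unity: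
  fixes G (structure)
  assumes "group G" and "finite (carrier G)" and "{s, t} \<subseteq> carrier G" and "s \<noteq> t"
    and "\<And>g. g \<in> carrier G \<Longrightarrow> \<exists>h. cayley_walk G s t h \<and> h 0 = g \<and> h n = g \<and> h (Suc n) = h (Suc 0)"
    and "x \<in> graph_eigenvalues (cayley_graph G {s, t})"
  obtains w v where "w * v = 1" and "x = w + v" and "w ^ n = 1"
proof -
  obtain f g where g: "g \<in> carrier G" "f g \<noteq> 0"
    and f: "\<And>g. g \<in> carrier G \<Longrightarrow> f (s \<otimes> g) + f (t \<otimes> g) = x * f g"
    using assms(4,6) unfolding graph_eigenvalues_cayley_iff[OF assms(1-3)] by auto
  obtain h where walk: "cayley_walk G s t h" and h: "h 0 = g" "h n = g" "h (Suc n) = h (Suc 0)"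
    using assms(5)[OF g(1)] by blast
  have "f (h k) + f (h (Suc (Suc k))) = x * f (h (Suc k))" for k
    using walk f[of "h (Suc k)"] doubleton_sum[of "h k" "h (Suc (Suc k))" _ _ f]
    unfolding cayley_walk_def by metis
  then have rec: "f (h (Suc (Suc k))) = x * f (h (Suc k)) - f (h k)" for k
    by (metis add_diff_cancel_left')
  show ?thesis
    by (rule periodic_recurrence_root[of "\<lambda>k. f (h k)" x n]) (use rec h g(2) that in auto)
qed

text \<open>The eigenfunction takes the value \<open>w ^ k\<close> at the \<open>k\<close>-th vertex
  of the walk and 0 elsewhere. The hypothesis \<open>root\<close> makes it well defined when a
  vertex is visited repeatedly.\<close>

lemma root_of_unity_imp_cayley_eigenvalue:
  fixes G (structure) and w v :: complex
  assumes "group G" and "finite (carrier G)" and "connection_set G {s, t}" and "s \<noteq> t"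
    and walk: "cayley_walk G s t h" and "n > 0" and period: "\<And>k. h (k + n) = h k"
    and root: "\<And>j k. h j = h k \<Longrightarrow> w ^ j = w ^ k" and wv: "w * v = 1"
  shows "w + v \<in> graph_eigenvalues (cayley_graph G {s, t})"
proof -
  interpret group G by fact
  have st: "s \<in> carrier G" "t \<in> carrier G" and inv: "\<And>r. r \<in> {s, t} \<Longrightarrow> inv r \<in> {s, t}"
    using assms(3) unfolding connection_set_def SET_INV_def by auto
  have h: "h k \<in> carrier G" "{h k, h (Suc (Suc k))} = {s \<otimes> h (Suc k), t \<otimes> h (Suc k)}" for k
    using walk unfolding cayley_walk_def by auto
  \<comment> \<open>Periodicity gives every vertex of the walk, including \<open>h 0\<close>, a
    predecessor on it.\<close>
  have shift: "h k = h (Suc (k + n - 1))" for k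
    using period[of k] assms(6) by simp
  define f where "f g = (if g \<in> range h then w ^ (SOME k. h k = g) else 0)" for g
  have f: "f (h k) = w ^ k" for k
  proof -
    have "h (SOME j. h j = h k) = h k"
      by (rule someI[of _ k]) simp
    then show ?thesis
      using root[of "SOME j. h j = h k" k] by (simp add: f_def)
  qed
  have "(\<Sum>r\<in>{s, t}. f (r \<otimes> g)) = (w + v) * f g" if g: "g \<in> carrier G" for g
  proof (cases "g \<in> range h")
    case True
    then obtain k where k: "g = h (Suc k)"
      using shift by (metis rangeE)
    have "(\<Sum>r\<in>{s, t}. f (r \<otimes> g)) = f (h k) + f (h (Suc (Suc k)))"
      using assms(4) doubleton_sum[OF h(2), of f k] by (simp add: k)
    also have "\<dots> = w * (v * w ^ k) + w * w * w ^ k"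
      using wv by (simp add: f flip: mult.assoc)
    also have "\<dots> = (w + v) * f g"
      by (simp add: f k algebra_simps)
    finally show ?thesis .
  next
    case False
    \<comment> \<open>A vertex off the walk has no neighbour on it:
      \<open>g = inv r \<otimes> (r \<otimes> g)\<close> would be a neighbour of a walk vertex, and
      both neighbours of such a vertex are on the walk.\<close>
    have "r \<otimes> g \<notin> range h" if r: "r \<in> {s, t}" for r
    proof
      assume "r \<otimes> g \<in> range h"
      then obtain k where "r \<otimes> g = h (Suc k)"
        using shift by (metis rangeE)
      moreover have "inv r \<otimes> (r \<otimes> g) = g"
        using g r st by (auto simp flip: m_assoc)
      ultimately have "inv r \<otimes> h (Suc k) = g"
        by simp
      then have "g \<in> {h k, h (Suc (Suc k))}"
        using inv[OF r] unfolding h(2) by auto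
      then show False
        using False by auto
    qed
    then show ?thesis
      using False by (simp add: f_def)
  qed
  moreover have "f (h 0) \<noteq> 0"
    by (simp add: f)
  moreover have "{s, t} \<subseteq> carrier G"
    using st by simp
  ultimately show ?thesis
    using graph_eigenvalues_cayley_iff[OF assms(1,2), of "{s, t}"] h(1)[of 0] by metis
qed

text \<open>Completing the square turns \<open>y^2 + y = 1\<close> and \<open>y^2 - y = 1\<close>
  into \<open>(2 y + 1)^2 = 5\<close> and \<open>(2 y - 1)^2 = 5\<close>, so every such
  \<open>y\<close> is a rational combination of 1 and the square root \<open>s = 2 * x + 1\<close>
  of 5.\<close>

lemma two_integral_if_golden_eigenvalues:
  assumes "\<And>y. y \<in> graph_eigenvalues \<Gamma> \<Longrightarrow> y = 2 \<or> y = -2 \<or> y\<^sup>2 + y = 1 \<or> y\<^sup>2 - y = 1"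
    and "x \<in> graph_eigenvalues \<Gamma>" and "x\<^sup>2 + x = 1"
  shows "two_integral \<Gamma>"
proof -
  define s where "s = 2 * x + 1"
  have "s\<^sup>2 = 4 * (x\<^sup>2 + x) + 1"
    by (simp add: s_def power2_eq_square algebra_simps)
  then have s5: "s\<^sup>2 = 5"
    by (simp add: assms(3))
  then have s: "s \<notin> \<rat>"
    by (rule irrational_if_square_eq_five)
  have half: "y = (b / 2) * s + (- a / 2)" if "2 * y + a = b * s" for y a b :: complex
  proof -
    have "y = (b * s - a) / 2"
      using that by (simp add: eq_divide_eq algebra_simps)
    then show ?thesis
      by (simp add: diff_divide_distrib)
  qed
  have "y \<in> {k * s + l | k l. k \<in> \<rat> \<and> l \<in> \<rat>}" if y: "y \<in> graph_eigenvalues \<Gamma>" for y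
  proof -
    have "\<exists>a\<in>{1, -1}. (2 * y + a)\<^sup>2 = s\<^sup>2" if "y\<^sup>2 + y = 1 \<or> y\<^sup>2 - y = 1"
      using that
    proof
      assume *: "y\<^sup>2 + y = 1"
      have "(2 * y + 1)\<^sup>2 = 4 * (y\<^sup>2 + y) + 1"
        by (simp add: power2_eq_square algebra_simps)
      then show ?thesis
        unfolding s5 * by simp
    next
      assume *: "y\<^sup>2 - y = 1"
      have "(2 * y + (-1))\<^sup>2 = 4 * (y\<^sup>2 - y) + 1"
        by (simp add: power2_eq_square algebra_simps)
      then show ?thesis
        unfolding s5 * by simp
    qed
    then have "\<exists>a\<in>{1, -1}. \<exists>b\<in>{1, -1}. 2 * y + a = b * s" if "y\<^sup>2 + y = 1 \<or> y\<^sup>2 - y = 1"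
      using that by (auto simp: power2_eq_iff)
    moreover have "y \<in> {k * s + l | k l. k \<in> \<rat> \<and> l \<in> \<rat>}"
      if "a \<in> {1, -1}" "b \<in> {1, -1}" "2 * y + a = b * s" for a b :: complex
    proof -
      have "b / 2 \<in> \<rat>" "- a / 2 \<in> \<rat>"
        using that(1,2) by auto
      then show ?thesis
        using half[OF that(3)] by blast
    qed
    ultimately have golden: ?thesis if "y\<^sup>2 + y = 1 \<or> y\<^sup>2 - y = 1"
      using that by blast
    have rational: ?thesis if "y \<in> \<rat>"
      using that by (auto intro: exI[of _ 0])
    show ?thesis
      using assms(1)[OF y]
    proof (elim disjE)
      assume "y = 2"
      then show ?thesis
        by (intro rational) simp
    next
      assume "y = - 2"
      then show ?thesis
        by (intro rational) simp
    qed (use golden in blast)+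
  qed
  moreover have "x \<notin> \<rat>"
  proof
    assume "x \<in> \<rat>"
    then have "s \<in> \<rat>"
      unfolding s_def by simp
    then show False
      using s by simp
  qed
  ultimately show ?thesis
    using two_integral_if_golden[OF s5 s] assms(2) by blast
qed

lemma exists_primitive_root_of_unity:
  assumes "n > 0"
  obtains w v :: complex where "w * v = 1" and "\<And>k. w ^ k = 1 \<longleftrightarrow> n dvd k"
proof
  define t where "t = 2 * pi / n"
  show "cis t * cis (- t) = 1"
    by (simp add: cis_mult)
  fix k :: nat
  have "cis t ^ k = 1 \<longleftrightarrow> cos (k * t) = 1"
    using cos_one_sin_zero[of "k * t"] by (auto simp: DeMoivre complex_eq_iff)
  also have "\<dots> \<longleftrightarrow> (\<exists>m::int. k * t = real_of_int m * 2 * pi)"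
    by (rule cos_one_2pi_int)
  also have "\<dots> \<longleftrightarrow> (\<exists>m::int. real k = of_int m * real n)"
    using assms by (simp add: t_def field_simps)
  also have "\<dots> \<longleftrightarrow> (\<exists>m::int. int k = m * int n)"
    by (metis of_int_eq_iff of_int_mult of_int_of_nat_eq)
  also have "\<dots> \<longleftrightarrow> n dvd k"
    by (metis dvd_def int_dvd_int_iff mult.commute)
  finally show "cis t ^ k = 1 \<longleftrightarrow> n dvd k" .
qed

lemma root_of_unity_power_cong:
  fixes w :: complex
  assumes "w ^ n = 1" and "j mod n = k mod n"
  shows "w ^ j = w ^ k"
proof -
  have "w ^ m = w ^ (m mod n)" for m
  proof -
    have "w ^ m = (w ^ n) ^ (m div n) * w ^ (m mod n)"
      by (simp flip: power_mult power_add)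
    then show ?thesis
      by (simp add: assms(1))
  qed
  then show ?thesis
    using assms(2) by metis
qed

section \<open>Walks and connection sets inside a group\<close>

context group
begin

lemma pow_eq_imp_ord_cong:
  assumes "x \<in> carrier G" and "x [^] j = x [^] (k::nat)"
  shows "j mod ord x = k mod ord x"
proof -
  have "j mod ord x = (j + d) mod ord x" if "x [^] j = x [^] (j + d)" for j d
  proof -
    have "x [^] j \<otimes> x [^] d = x [^] j \<otimes> \<one>"
      using assms(1) by (simp add: nat_pow_mult that[symmetric])
    then have "ord x dvd d"
      using assms(1) by (simp add: pow_eq_id)
    then show ?thesis
      by auto
  qed
  then show ?thesis
    using assms(2) by (metis nat_le_linear le_Suc_ex)
qed

lemma pow_gcd_eq_one:
  assumes "x \<in> carrier G" and "x [^] m = \<one>" and "x [^] n = \<one>" and "gcd m n dvd (k::nat)"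
  shows "x [^] k = \<one>"
  using assms by (metis dvd_trans gcd_greatest pow_eq_id)

lemma involution_inv: "x \<in> carrier G \<Longrightarrow> x \<otimes> x = \<one> \<Longrightarrow> inv x = x"
  by (simp add: inv_equality)

lemma pow_two: "x \<in> carrier G \<Longrightarrow> x [^] (2::nat) = x \<otimes> x"
  by (simp add: numeral_2_eq_2)

lemma cayley_walk_cyclic:
  assumes "x \<in> carrier G" and "g \<in> carrier G"
  shows "cayley_walk G x (inv x) (\<lambda>k. x [^] k \<otimes> g)"
proof -
  have step: "x \<otimes> (x [^] k \<otimes> g) = x [^] Suc k \<otimes> g" for k
    using assms by (simp add: m_assoc[symmetric] nat_pow_Suc2[symmetric] del: nat_pow_Suc)
  have unstep: "inv x \<otimes> (x [^] Suc k \<otimes> g) = x [^] k \<otimes> g" for k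
    unfolding step[symmetric] using assms by (simp flip: m_assoc)
  show ?thesis
    unfolding cayley_walk_def step unstep using assms by (simp add: insert_commute del: nat_pow_Suc)
qed

definition alternating_walk :: "'a \<Rightarrow> 'a \<Rightarrow> 'a \<Rightarrow> nat \<Rightarrow> 'a" where
  "alternating_walk s t g = rec_nat g (\<lambda>k y. (if even k then s else t) \<otimes> y)"

lemma alternating_walk_simps [simp]:
  "alternating_walk s t g 0 = g"
  "alternating_walk s t g (Suc k) = (if even k then s else t) \<otimes> alternating_walk s t g k"
  by (simp_all add: alternating_walk_def)

lemma alternating_walk_closed:
  assumes "s \<in> carrier G" and "t \<in> carrier G" and "g \<in> carrier G"
  shows "alternating_walk s t g k \<in> carrier G"
  by (induction k) (use assms in auto)

text \<open>One neighbour is reached by the next letter of the word; the other is the previous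
  vertex, since applying the last letter again undoes it.\<close>

lemma cayley_walk_alternating:
  assumes "s \<in> carrier G" and "t \<in> carrier G" and "g \<in> carrier G" and "s \<otimes> s = \<one>" and "t \<otimes> t = \<one>"
  shows "cayley_walk G s t (alternating_walk s t g)"
proof -
  have "s \<otimes> (s \<otimes> y) = y" "t \<otimes> (t \<otimes> y) = y" if "y \<in> carrier G" for y
    using assms that by (simp_all flip: m_assoc)
  then show ?thesis
    unfolding cayley_walk_def using alternating_walk_closed[OF assms(1-3)] by auto
qed

lemma alternating_walk_even:
  assumes "s \<in> carrier G" and "t \<in> carrier G" and "g \<in> carrier G"
  shows "alternating_walk s t g (2 * k) = (t \<otimes> s) [^] k \<otimes> g"
proof (induction k)
  case (Suc k)
  have "alternating_walk s t g (2 * Suc k) = t \<otimes> (s \<otimes> ((t \<otimes> s) [^] k \<otimes> g))"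
    by (simp add: Suc)
  also have "\<dots> = (t \<otimes> s) \<otimes> (t \<otimes> s) [^] k \<otimes> g"
    using assms by (simp add: m_assoc)
  also have "\<dots> = (t \<otimes> s) [^] Suc k \<otimes> g"
    using assms nat_pow_Suc2[of "t \<otimes> s" k] by simp
  finally show ?case .
qed (use assms in simp)

text \<open>After \<open>2 * n\<close> steps the walk is back at
  \<open>(t \<otimes> s) [^] n \<otimes> g = g\<close>, and the even shift preserves the parity that
  selects the next letter.\<close>

lemma alternating_walk_period:
  assumes "s \<in> carrier G" and "t \<in> carrier G" and "g \<in> carrier G" and "(t \<otimes> s) [^] n = \<one>"
  shows "alternating_walk s t g (k + 2 * n) = alternating_walk s t g k"
  by (induction k) (use assms alternating_walk_even[OF assms(1-3), of n] in simp_all)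

lemma connection_set_inverse_pair:
  assumes "x \<in> carrier G" and "x \<noteq> \<one>"
  shows "connection_set G {x, inv x}"
proof -
  have "\<one> \<noteq> inv x"
    using assms by (metis inv_inv inv_one)
  then show ?thesis
    unfolding connection_set_def SET_INV_def using assms by auto
qed

lemma connection_set_involutions:
  assumes "s \<in> carrier G" and "t \<in> carrier G" and "s \<noteq> \<one>" and "t \<noteq> \<one>" and "s \<otimes> s = \<one>" and "t \<otimes> t = \<one>"
  shows "connection_set G {s, t}"
proof -
  have "inv s = s" "inv t = t"
    using assms by (simp_all add: involution_inv)
  then show ?thesis
    unfolding connection_set_def SET_INV_def using assms(1-4) by auto
qed

end

section \<open>Spectra for inverse pairs and for pairs of involutions\<close>

context group
begin

text \<open>The walk through \<open>x [^] k \<otimes> g\<close> closes after \<open>n\<close> steps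
  for any exponent \<open>n\<close> with \<open>x [^] n = \<one>\<close>; the condition on
  \<open>x \<otimes> x\<close> makes \<open>x\<close> and \<open>inv x\<close> distinct.\<close>

lemma cyclic_pair_eigenvalue:
  assumes "finite (carrier G)" and "x \<in> carrier G" and "x \<otimes> x \<noteq> \<one>" and "x [^] n = \<one>" and "n > 0"
    and "y \<in> graph_eigenvalues (cayley_graph G {x, inv x})"
  obtains w v where "w * v = 1" and "y = w + v" and "w ^ n = 1"
proof (rule cayley_eigenvalue_imp_root_of_unity[OF is_group assms(1) _ _ _ assms(6)])
  show "{x, inv x} \<subseteq> carrier G"
    using assms(2) by simp
  show "x \<noteq> inv x"
    using assms(2,3) r_inv by metis
  show "\<exists>h. cayley_walk G x (inv x) h \<and> h 0 = g \<and> h n = g \<and> h (Suc n) = h (Suc 0)" if "g \<in> carrier G" for g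
    using assms(2,4) that
    by (intro exI[of _ "\<lambda>k. x [^] k \<otimes> g"]) (simp add: cayley_walk_cyclic)
qed (use that in auto)

lemma involution_pair_eigenvalue:
  assumes "finite (carrier G)" and "s \<in> carrier G" and "t \<in> carrier G" and "s \<noteq> t"
    and "s \<otimes> s = \<one>" and "t \<otimes> t = \<one>" and "(t \<otimes> s) [^] n = \<one>"
    and "y \<in> graph_eigenvalues (cayley_graph G {s, t})"
  obtains w v where "w * v = 1" and "y = w + v" and "w ^ (2 * n) = 1"
proof (rule cayley_eigenvalue_imp_root_of_unity[OF is_group assms(1) _ assms(4) _ assms(8)])
  show "{s, t} \<subseteq> carrier G"
    using assms(2,3) by simp
  show "\<exists>h. cayley_walk G s t h \<and> h 0 = g \<and> h (2 * n) = g \<and> h (Suc (2 * n)) = h (Suc 0)" if "g \<in> carrier G" for g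
    using alternating_walk_period[OF assms(2,3) that assms(7), of 0]
      cayley_walk_alternating[OF assms(2,3) that assms(5,6)]
    by (intro exI[of _ "alternating_walk s t g"]) simp
qed (use that in auto)

lemma cyclic_pair_has_eigenvalue:
  fixes w v :: complex
  assumes "finite (carrier G)" and "x \<in> carrier G" and "x \<otimes> x \<noteq> \<one>" and "w * v = 1" and "w ^ ord x = 1"
  shows "w + v \<in> graph_eigenvalues (cayley_graph G {x, inv x})"
proof (rule root_of_unity_imp_cayley_eigenvalue[OF is_group assms(1) _ _ cayley_walk_cyclic _ _ _ assms(4)])
  have "x \<noteq> \<one>"
    using assms(3) by auto
  then show "connection_set G {x, inv x}"
    by (intro connection_set_inverse_pair assms(2))
  show "x \<noteq> inv x"
    using assms(2,3) r_inv by metis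
  show "ord x > 0"
    using ord_ge_1[OF assms(1,2)] by simp
  show "x [^] (k + ord x) \<otimes> \<one> = x [^] k \<otimes> \<one>" for k
    using assms(2) by (simp flip: nat_pow_mult)
  show "w ^ j = w ^ k" if "x [^] j \<otimes> \<one> = x [^] k \<otimes> \<one>" for j k
    using that assms(2,5) pow_eq_imp_ord_cong[of x j k] by (intro root_of_unity_power_cong[of w "ord x"]) auto
qed (use assms in auto)

text \<open>The alternating walk from \<open>\<one>\<close> has period 10. Its even vertices are the
  powers of \<open>t \<otimes> s\<close>, an element of order exactly 5, and its odd vertices never
  meet the even ones, so repeated visits have congruent indices.\<close>

lemma involution_pair_has_eigenvalue:
  fixes w v :: complex
  assumes "finite (carrier G)" and st: "s \<in> carrier G" "t \<in> carrier G" "s \<noteq> t" "s \<noteq> \<one>" "t \<noteq> \<one>"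
    and inv: "s \<otimes> s = \<one>" "t \<otimes> t = \<one>" and y5: "(t \<otimes> s) [^] (5::nat) = \<one>" and wv: "w * v = 1" and w5: "w ^ 5 = 1"
  shows "w + v \<in> graph_eigenvalues (cayley_graph G {s, t})"
proof (rule root_of_unity_imp_cayley_eigenvalue[OF is_group assms(1) _ st(3) _ _ _ _ wv])
  let ?h = "alternating_walk s t \<one>"
  let ?y = "t \<otimes> s"
  have y: "?y \<in> carrier G"
    using st by simp
  have "?y \<noteq> \<one>"
    using st inv by (metis inv_equality involution_inv)
  moreover have "ord ?y dvd 5"
    using y5 y by (simp add: pow_eq_id)
  moreover have "d = 1 \<or> d = 5" if "d dvd 5" for d :: nat
  proof -
    have "d \<in> {..5}"
      using that dvd_imp_le[of d 5] by simp
    then have "d \<in> {0, 1, 2, 3, 4, 5}"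
      by auto
    then show ?thesis
      using that by auto
  qed
  ultimately have ord: "ord ?y = 5"
    using y ord_eq_1 by blast
  show "connection_set G {s, t}"
    by (intro connection_set_involutions st inv)
  show "cayley_walk G s t ?h"
    by (intro cayley_walk_alternating st inv) simp
  show "?h (k + 2 * 5) = ?h k" for k
    by (intro alternating_walk_period st y5) simp
  have even: "?h (2 * k) = ?y [^] k" for k
    using alternating_walk_even[OF st(1,2) one_closed] y by simp
  have odd: "?h (Suc (2 * k)) = s \<otimes> ?y [^] k" for k
    by (simp add: even)
  \<comment> \<open>Equality would make \<open>s\<close> a power of \<open>?y\<close>, with
    \<open>?y [^] (4 * b)\<close> serving as the inverse of \<open>?y [^] b\<close>. Then
    \<open>s\<close> has exponents 5 and 2 and is trivial.\<close>
  have mixed: "s \<otimes> ?y [^] b \<noteq> ?y [^] a" for a b :: nat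
  proof
    assume eq: "s \<otimes> ?y [^] b = ?y [^] a"
    have "?y [^] (b + 4 * b) = (?y [^] (5::nat)) [^] b"
      using y by (simp add: nat_pow_pow)
    then have "s = s \<otimes> ?y [^] b \<otimes> ?y [^] (4 * b)"
      using st y y5 by (simp add: m_assoc nat_pow_mult)
    then have s: "s = ?y [^] (a + 4 * b)"
      unfolding eq using y by (simp add: nat_pow_mult)
    have "s [^] (5::nat) = (?y [^] (5::nat)) [^] (a + 4 * b)"
      using y by (subst s) (simp add: nat_pow_pow mult.commute)
    then have "s [^] (5::nat) = \<one>"
      using y5 by simp
    moreover have "s [^] (2::nat) = \<one>"
      using st inv by (simp add: pow_two)
    ultimately have "s [^] (1::nat) = \<one>"
      using pow_gcd_eq_one[of s 5 2 1] st by simp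
    then show False
      using st by simp
  qed
  show "w ^ j = w ^ k" if eq: "?h j = ?h k" for j k
  proof -
    define a b where "a = j div 2" and "b = k div 2"
    have "\<exists>e \<in> {0, 1}. j = 2 * a + e \<and> k = 2 * b + e \<and> ?y [^] a = ?y [^] b"
    proof (cases "even j"; cases "even k")
      assume p: "even j" "even k"
      then have jk: "j = 2 * a" "k = 2 * b"
        by (auto simp: a_def b_def)
      then show ?thesis
        using eq unfolding jk even by auto
    next
      assume p: "odd j" "odd k"
      then have jk: "j = Suc (2 * a)" "k = Suc (2 * b)"
        by (auto simp: a_def b_def)
      then have "?y [^] a = ?y [^] b"
        using eq st y unfolding jk odd by simp
      then show ?thesis
        using jk by auto
    next
      assume "even j" "odd k"
      then have jk: "j = 2 * a" "k = Suc (2 * b)"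
        by (auto simp: a_def b_def)
      then show ?thesis
        using eq mixed[of b a] unfolding jk odd even by simp
    next
      assume "odd j" "even k"
      then have jk: "j = Suc (2 * a)" "k = 2 * b"
        by (auto simp: a_def b_def)
      then show ?thesis
        using eq mixed[of a b] unfolding jk odd even by simp
    qed
    then obtain e where e: "j = 2 * a + e" "k = 2 * b + e" "?y [^] a = ?y [^] b"
      by blast
    then have "a mod 5 = b mod 5"
      using pow_eq_imp_ord_cong[OF y e(3)] ord by simp
    then have "j mod 5 = k mod 5"
      unfolding e by (metis mod_add_left_eq mod_mult_right_eq)
    then show ?thesis
      by (rule root_of_unity_power_cong[OF w5])
  qed
qed simp

lemma card_inverse_pair:
  assumes "x \<in> carrier G" and "x \<otimes> x \<noteq> \<one>"
  shows "card {x, inv x} = 2"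
  using assms r_inv by (metis card_2_iff)

section \<open>Elements and involutions of groups in the class\<close>

text \<open>An irrational eigenvalue of the graph of \<open>{x, inv x}\<close> excludes exponents 3
  and 4. A root of unity \<open>w\<close> of order exactly \<open>ord x\<close> gives an eigenvalue
  \<open>w + v\<close> of degree at most two, and the resulting bound on the order of
  \<open>w\<close> passes back to \<open>x\<close>.\<close>

lemma class_B_element_power:
  assumes "G \<in> class_B 2" and x: "x \<in> carrier G" and "x \<otimes> x \<noteq> \<one>"
  shows "x [^] (3::nat) \<noteq> \<one>" and "x [^] (4::nat) \<noteq> \<one>"
    and "x [^] (8::nat) = \<one> \<or> x [^] (10::nat) = \<one> \<or> x [^] (12::nat) = \<one>"
proof -
  have fin: "finite (carrier G)"
    using assms(1) by (simp add: class_B_def)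
  have "x \<noteq> \<one>"
    using assms(3) by auto
  then have int: "two_integral (cayley_graph G {x, inv x})"
    using assms(1) card_inverse_pair[OF x assms(3)] connection_set_inverse_pair[OF x]
    by (auto simp: class_B_def)
  obtain y where y: "y \<in> graph_eigenvalues (cayley_graph G {x, inv x})" "y \<notin> \<rat>"
    using two_integral_imp_irrational_eigenvalue[OF int] by blast
  have "x [^] n \<noteq> \<one>" if n: "n \<in> {3, 4}" for n :: nat
  proof
    assume xn: "x [^] n = \<one>"
    have "n > 0"
      using n by auto
    then obtain w v where "w * v = 1" "y = w + v" "w ^ n = 1"
      using cyclic_pair_eigenvalue[OF fin x assms(3) xn _ y(1)] by blast
    then show False
      using third_or_fourth_root_joukowski_rational[of w v] n y(2) by auto
  qed
  then show "x [^] (3::nat) \<noteq> \<one>" "x [^] (4::nat) \<noteq> \<one>"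
    by simp_all
  have ord: "ord x > 0"
    using ord_ge_1[OF fin x] by simp
  obtain w v :: complex where wv: "w * v = 1" and w: "\<And>k. w ^ k = 1 \<longleftrightarrow> ord x dvd k"
    using exists_primitive_root_of_unity[OF ord] by blast
  have "w + v \<in> graph_eigenvalues (cayley_graph G {x, inv x})"
    using w by (intro cyclic_pair_has_eigenvalue fin x assms(3) wv) auto
  then obtain p :: "int poly" where "p \<noteq> 0" "degree p \<le> 2" "poly (of_int_poly p) (w + v) = 0"
    using two_integral_eigenvalue_quadratic[OF int] by blast
  then have "w ^ 8 = 1 \<or> w ^ 10 = 1 \<or> w ^ 12 = 1"
    using w ord by (intro quadratic_root_of_unity_order[of w "ord x" v p] wv) auto
  then show "x [^] (8::nat) = \<one> \<or> x [^] (10::nat) = \<one> \<or> x [^] (12::nat) = \<one>"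
    unfolding w pow_eq_id[OF x] .
qed

text \<open>Exponents 8 and 12 are ruled out by applying the preceding restrictions to powers of
  \<open>x\<close>.\<close>

lemma class_B_pow_ten:
  assumes "G \<in> class_B 2" and x: "x \<in> carrier G"
  shows "x [^] (10::nat) = \<one>"
proof (rule ccontr)
  assume 10: "x [^] (10::nat) \<noteq> \<one>"
  have pow: "(x [^] a) [^] b = x [^] (a * b)" for a b :: nat
    using x by (simp add: nat_pow_pow)
  have sq: "x \<otimes> x \<noteq> \<one>"
  proof
    assume "x \<otimes> x = \<one>"
    then have "(x [^] (2::nat)) [^] (5::nat) = \<one>"
      using x by (simp add: pow_two)
    then show False
      using 10 by (simp add: pow)
  qed
  consider "x [^] (8::nat) = \<one>" | "x [^] (12::nat) = \<one>"
    using class_B_element_power(3)[OF assms sq] 10 by blast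
  then show False
  proof cases
    case 1
    \<comment> \<open>Here \<open>y\<close> has exponent 4 but is not of exponent 2, since
      \<open>x [^] 4 \<noteq> \<one>\<close>.\<close>
    define y where "y = x [^] (2::nat)"
    have "y [^] (2::nat) = x [^] (4::nat)" "y [^] (4::nat) = \<one>"
      unfolding y_def pow using 1 by simp_all
    then have y: "y \<in> carrier G" "y \<otimes> y = x [^] (4::nat)" "y [^] (4::nat) = \<one>"
      using x by (simp_all add: y_def pow_two)
    then show False
      using class_B_element_power(2)[OF assms(1) y(1)] class_B_element_power(2)[OF assms sq] by simp
  next
    case 2
    \<comment> \<open>Exponent 3 is possible only if \<open>y \<otimes> y = \<one>\<close>; both
      together make \<open>y\<close> trivial, against
      \<open>x [^] 4 \<noteq> \<one>\<close>.\<close>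
    define y where "y = x [^] (4::nat)"
    have y: "y \<in> carrier G" "y [^] (3::nat) = \<one>"
      unfolding y_def pow using x 2 by simp_all
    then have "y [^] (2::nat) = \<one>"
      using class_B_element_power(1)[OF assms(1) y(1)] by (auto simp: pow_two)
    then have "y [^] (1::nat) = \<one>"
      using pow_gcd_eq_one[of y 3 2 1] y by simp
    then show False
      using class_B_element_power(2)[OF assms sq] y(1) by (simp add: y_def)
  qed
qed

text \<open>Otherwise the walk closes after four steps, and all eigenvalues are rational.\<close>

lemma class_B_involutions_not_commute:
  assumes "G \<in> class_B 2" and st: "s \<in> carrier G" "t \<in> carrier G" "s \<noteq> t" "s \<noteq> \<one>" "t \<noteq> \<one>"
    and inv: "s \<otimes> s = \<one>" "t \<otimes> t = \<one>"
  shows "(t \<otimes> s) \<otimes> (t \<otimes> s) \<noteq> \<one>"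
proof
  assume "(t \<otimes> s) \<otimes> (t \<otimes> s) = \<one>"
  then have 2: "(t \<otimes> s) [^] (2::nat) = \<one>"
    using st by (simp add: pow_two)
  have fin: "finite (carrier G)"
    using assms(1) by (simp add: class_B_def)
  have "two_integral (cayley_graph G {s, t})"
    using assms(1) st connection_set_involutions[OF st(1,2,4,5) inv] by (auto simp: class_B_def)
  then obtain y where y: "y \<in> graph_eigenvalues (cayley_graph G {s, t})" "y \<notin> \<rat>"
    using two_integral_imp_irrational_eigenvalue by blast
  obtain w v where "w * v = 1" "y = w + v" "w ^ (2 * 2) = 1"
    using involution_pair_eigenvalue[OF fin st(1-3) inv 2 y(1)] .
  then show False
    using third_or_fourth_root_joukowski_rational[of w v] y(2) by simp
qed

end

section \<open>Groups with 2-integral Cayley graphs of valency two\<close>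

text \<open>All eigenvalues come from tenth roots of unity, and a primitive fifth root supplies the
  irrational one, both for an inverse pair and for two involutions.\<close>

lemma (in group) class_BI:
  assumes fin: "finite (carrier G)" and pow: "\<And>x. x \<in> carrier G \<Longrightarrow> x [^] (10::nat) = \<one>"
    and invol: "\<And>s t. \<lbrakk>s \<in> carrier G; t \<in> carrier G; s \<noteq> \<one>; t \<noteq> \<one>; s \<otimes> s = \<one>; t \<otimes> t = \<one>\<rbrakk>
      \<Longrightarrow> (t \<otimes> s) [^] (5::nat) = \<one>"
  shows "G \<in> class_B 2"
proof -
  obtain w v :: complex where wv: "w * v = 1" and w: "\<And>k. w ^ k = 1 \<longleftrightarrow> 5 dvd k"
    using exists_primitive_root_of_unity[of 5] by auto
  have w5: "w ^ 5 = 1"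
    using w by simp
  moreover have "w \<noteq> 1"
    using w[of 1] by simp
  ultimately have golden: "(w + v)\<^sup>2 + (w + v) = 1"
    by (intro fifth_root_golden wv)
  have "two_integral (cayley_graph G S)" if S: "connection_set G S" and "2 \<le> card S" "card S \<le> 2" for S
  proof -
    have "card S = 2"
      using that by simp
    then obtain s t where st: "S = {s, t}" "s \<noteq> t"
      by (meson card_2_iff)
    have carrier: "s \<in> carrier G" "t \<in> carrier G" and one: "s \<noteq> \<one>" "t \<noteq> \<one>"
      and inv: "inv s \<in> {s, t}" "inv t \<in> {s, t}"
      using S unfolding connection_set_def SET_INV_def st(1) by auto
    show ?thesis
    proof (cases "inv s = t")
      case True
      have sq: "s \<otimes> s \<noteq> \<one>"
        using True st(2) involution_inv[OF carrier(1)] by auto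
      \<comment> \<open>The order is thus 5 or 10, so the fifth root of unity \<open>w\<close>
        satisfies \<open>w ^ ord s = 1\<close>.\<close>
      have "ord s dvd 10" "\<not> ord s dvd 2"
        using pow[OF carrier(1)] sq carrier by (simp_all add: pow_eq_id[symmetric] pow_two)
      moreover have "5 dvd d" if "d dvd 10" "\<not> d dvd 2" for d :: nat
      proof (rule ccontr)
        assume "\<not> 5 dvd d"
        moreover have "prime_elem (5 :: nat)"
          by simp
        ultimately have "coprime d 5"
          by (metis prime_elem_imp_coprime coprime_commute)
        then show False
          using that coprime_dvd_mult_left_iff[of d 5 2] by simp
      qed
      ultimately have "w ^ ord s = 1"
        unfolding w by blast
      then have "w + v \<in> graph_eigenvalues (cayley_graph G S)"
        using cyclic_pair_has_eigenvalue[OF fin carrier(1) sq wv] by (simp add: st(1) True)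
      moreover have "y = 2 \<or> y = -2 \<or> y\<^sup>2 + y = 1 \<or> y\<^sup>2 - y = 1"
        if "y \<in> graph_eigenvalues (cayley_graph G S)" for y
      proof -
        have y: "y \<in> graph_eigenvalues (cayley_graph G {s, inv s})"
          using that by (simp add: st(1) True)
        obtain w v where "w * v = 1" "y = w + v" "w ^ 10 = 1"
          using cyclic_pair_eigenvalue[OF fin carrier(1) sq pow[OF carrier(1)] _ y] by auto
        then show ?thesis
          using tenth_root_joukowski by simp
      qed
      ultimately show ?thesis
        using two_integral_if_golden_eigenvalues golden by blast
    next
      case False
      then have "inv s = s"
        using inv by auto
      moreover from this have "inv t = t"
        using inv st(2) carrier by (metis inv_inv insertE singletonD)
      ultimately have sq: "s \<otimes> s = \<one>" "t \<otimes> t = \<one>"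
        using r_inv carrier by metis+
      have ts: "(t \<otimes> s) [^] (5::nat) = \<one>"
        by (rule invol[OF carrier one sq])
      have "w + v \<in> graph_eigenvalues (cayley_graph G S)"
        unfolding st(1) by (rule involution_pair_has_eigenvalue[OF fin carrier st(2) one sq ts wv w5])
      moreover have "y = 2 \<or> y = -2 \<or> y\<^sup>2 + y = 1 \<or> y\<^sup>2 - y = 1"
        if y: "y \<in> graph_eigenvalues (cayley_graph G S)" for y
      proof -
        obtain w v where "w * v = 1" "y = w + v" "w ^ (2 * 5) = 1"
          using involution_pair_eigenvalue[OF fin carrier st(2) sq ts y[unfolded st(1)]] .
        then show ?thesis
          using tenth_root_joukowski[of w v] by simp
      qed
      ultimately show ?thesis
        using two_integral_if_golden_eigenvalues golden by blast
    qed
  qed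
  then show ?thesis
    unfolding class_B_def using fin is_group by blast
qed

section \<open>Exponents, subgroups of index two and the group order\<close>

lemma (in group) group_exponent_pow:
  assumes "finite (carrier G)" and "x \<in> carrier G"
  shows "x [^] group_exponent G = \<one>"
proof -
  have "Coset.order G > 0 \<and> (\<forall>x\<in>carrier G. x [^] Coset.order G = \<one>)"
    using assms(1) by (simp add: order_gt_0_iff_finite pow_order_eq_1)
  from LeastI[of "\<lambda>n. n > 0 \<and> (\<forall>x\<in>carrier G. x [^] n = \<one>)", OF this] show ?thesis
    using assms(2) unfolding group_exponent_def by blast
qed

text \<open>A smaller positive exponent would be coprime to \<open>p\<close> and make the group
  trivial.\<close>

lemma (in group) group_exponent_eq_primeI:
  assumes "Factorial_Ring.prime p" and "\<And>x. x \<in> carrier G \<Longrightarrow> x [^] p = \<one>" and "carrier G \<noteq> {\<one>}"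
  shows "group_exponent G = p"
  unfolding group_exponent_def
proof (rule Least_equality)
  show "p > 0 \<and> (\<forall>x\<in>carrier G. x [^] p = \<one>)"
    using assms(1,2) prime_gt_0_nat by blast
  fix n :: nat assume n: "n > 0 \<and> (\<forall>x\<in>carrier G. x [^] n = \<one>)"
  show "p \<le> n"
  proof (rule ccontr)
    assume "\<not> p \<le> n"
    then have "\<not> p dvd n"
      using n by (auto dest: dvd_imp_le)
    then have "gcd p n = 1"
      using assms(1) by (metis prime_imp_coprime coprime_imp_gcd_eq_1)
    then have "x = \<one>" if "x \<in> carrier G" for x
      using pow_gcd_eq_one[of x p n 1] assms(2) n that by simp
    then show False
      using assms(3) by blast
  qed
qed

text \<open>There is only one right coset besides \<open>P\<close>, so \<open>a\<close> and
  \<open>inv b\<close> lie in the same one.\<close>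

lemma (in group) index_two_mult_closed:
  assumes "subgroup P G" and "subgroup_index G P = 2"
    and ab: "a \<in> carrier G" "b \<in> carrier G" "a \<notin> P" "b \<notin> P"
  shows "a \<otimes> b \<in> P"
proof -
  interpret P: subgroup P G by fact
  have "P #> \<one> = P"
    using P.subset by (simp add: coset_mult_one)
  have in_P: "x \<in> P" if "P #> x = P" "x \<in> carrier G" for x
    using rcos_self[OF that(2) assms(1)] that(1) by simp
  have "inv b \<notin> P"
    using ab P.m_inv_closed by fastforce
  then have "P #> a \<noteq> P" "P #> inv b \<noteq> P"
    using in_P ab by auto
  moreover have "P \<in> rcosets P" "P #> a \<in> rcosets P" "P #> inv b \<in> rcosets P"
    using \<open>P #> \<one> = P\<close> ab P.subset rcosetsI[of P] by (metis one_closed, auto)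
  moreover obtain A B where "rcosets P = {A, B}"
    using assms(2) unfolding subgroup_index_def by (meson card_2_iff)
  ultimately have "P #> inv b = P #> a"
    by auto
  then have "a \<in> P #> inv b"
    using repr_independenceD[OF assms(1) ab(1)] by blast
  then show ?thesis
    using P.rcos_module_imp[OF is_group, of "inv b" a] ab by simp
qed

text \<open>Cauchy's theorem, from Sylow's theorem for a subgroup of order
  \<open>p ^ 1\<close>.\<close>

lemma (in group) subgroup_element_of_prime_order:
  assumes "finite (carrier G)" and "Factorial_Ring.prime p" and "p dvd Coset.order G"
  obtains x where "x \<in> carrier G" and "x \<noteq> \<one>" and "x [^] p = \<one>"
proof -
  obtain m where "Coset.order G = p ^ 1 * m"
    using assms(3) by auto
  then obtain H where H: "subgroup H G" "card H = p ^ 1"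
    using sylow_thm[OF assms(2) is_group _ assms(1)] by blast
  interpret H: subgroup H G by fact
  have "card H > 1"
    using H(2) assms(2) prime_gt_1_nat by simp
  then obtain x where x: "x \<in> H" "x \<noteq> \<one>"
    by (metis One_nat_def card_le_Suc0_iff_eq not_le card.infinite not_one_less_zero H.one_closed)
  moreover have "x [^]\<^bsub>G\<lparr>carrier := H\<rparr>\<^esub> card H = \<one>"
    using group.pow_order_eq_1[OF H.subgroup_is_group[OF is_group], of x] x(1) by (simp add: Coset.order_def)
  ultimately show ?thesis
    using that[of x] H.subset H(2) by (simp add: nat_pow_consistent[symmetric] subsetD)
qed

text \<open>By Cauchy's theorem only the primes 2 and 5 divide the order; the part \<open>m\<close>
  prime to 5 is a power of 2 and not divisible by 4.\<close>

lemma (in group) order_if_pow_ten: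
  assumes fin: "finite (carrier G)" and pow: "\<And>x. x \<in> carrier G \<Longrightarrow> x [^] (10::nat) = \<one>"
    and not4: "\<not> 4 dvd Coset.order G"
  shows "\<exists>b. Coset.order G = 5 ^ b \<or> Coset.order G = 2 * 5 ^ b"
proof -
  have prime: "p = 2 \<or> p = 5" if p: "Factorial_Ring.prime p" "p dvd Coset.order G" for p
  proof -
    obtain x where x: "x \<in> carrier G" "x \<noteq> \<one>" "x [^] p = \<one>"
      using subgroup_element_of_prime_order[OF fin p] .
    have "p dvd 10"
    proof (rule ccontr)
      assume "\<not> p dvd 10"
      then have "gcd p 10 = 1"
        using p(1) by (metis prime_imp_coprime coprime_imp_gcd_eq_1)
      then show False
        using pow_gcd_eq_one[of x p 10 1] x pow by simp
    qed
    then have "p dvd 2 \<or> p dvd 5"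
      using p(1) prime_dvd_mult_iff[of p 2 5] by simp
    then show ?thesis
      using p(1) primes_dvd_imp_eq[of p 2] primes_dvd_imp_eq[of p 5] by auto
  qed
  have "Coset.order G \<noteq> 0"
    using fin order_gt_0_iff_finite by simp
  then obtain m where m: "Coset.order G = 5 ^ multiplicity 5 (Coset.order G) * m" "\<not> 5 dvd m"
    using multiplicity_decompose'[of "Coset.order G" 5] by auto
  have m_prime: "p = 2" if "Factorial_Ring.prime p" "p dvd m" for p
    using prime[OF that(1)] that m by (metis dvd_mult)
  show ?thesis
  proof (cases "m = 1")
    case True
    then show ?thesis
      using m by auto
  next
    case False
    then obtain p where "Factorial_Ring.prime p" "p dvd m"
      using prime_factor_nat by blast
    then obtain m' where m': "m = 2 * m'"
      using m_prime by blast
    have "m' = 1"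
    proof (rule ccontr)
      assume "m' \<noteq> 1"
      then obtain p where p: "Factorial_Ring.prime p" "p dvd m'"
        using prime_factor_nat by blast
      then have "p = 2"
        using m_prime m' by auto
      then obtain k where "m' = 2 * k"
        using p(2) by blast
      then have "Coset.order G = 4 * (5 ^ multiplicity 5 (Coset.order G) * k)"
        using m(1) m' by simp
      then show False
        using not4 by (metis dvd_triv_left)
    qed
    then have "Coset.order G = 2 * 5 ^ multiplicity 5 (Coset.order G)"
      using m(1) m' by simp
    then show ?thesis
      by blast
  qed
qed

text \<open>In a subgroup of order 4 all elements have exponent \<open>gcd 4 10 = 2\<close>, so it
  contains two distinct involutions whose product squares to \<open>\<one>\<close>.\<close>

lemma (in group) class_B_order_not_dvd_four:
  assumes "G \<in> class_B 2"
  shows "\<not> 4 dvd Coset.order G"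
proof
  assume "4 dvd Coset.order G"
  then obtain m where "Coset.order G = 2 ^ 2 * m"
    by auto
  moreover have fin: "finite (carrier G)"
    using assms by (simp add: class_B_def)
  ultimately obtain H where H: "subgroup H G" "card H = 2 ^ 2"
    using sylow_thm[OF two_is_prime_nat is_group] by blast
  interpret H: subgroup H G by fact
  have sq: "x \<otimes> x = \<one>" if x: "x \<in> H" for x
  proof -
    have "x [^]\<^bsub>G\<lparr>carrier := H\<rparr>\<^esub> card H = \<one>"
      using group.pow_order_eq_1[OF H.subgroup_is_group[OF is_group], of x] x by (simp add: Coset.order_def)
    then have "x [^] (4::nat) = \<one>"
      using H(2) by (simp add: nat_pow_consistent[symmetric])
    then have "x [^] (2::nat) = \<one>"
      using pow_gcd_eq_one[of x 4 10 2] class_B_pow_ten[OF assms] x H.subset by (simp add: subsetD gcd_nat.simps)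
    then show ?thesis
      using x H.subset by (simp add: pow_two subsetD)
  qed
  have "card (H - {\<one>}) = 3"
    using H(2) H.one_closed by simp
  then obtain s t u where "H - {\<one>} = {s, t, u}" "s \<noteq> t"
    unfolding card_3_iff by blast
  then have st: "s \<in> H" "t \<in> H" "s \<noteq> t" "s \<noteq> \<one>" "t \<noteq> \<one>"
    by auto
  then show False
    using class_B_involutions_not_commute[OF assms, of s t] sq[of s] sq[of t] sq[of "t \<otimes> s"] H.subset
    by auto
qed

section \<open>The classification\<close>

lemma (in group) class_B_two_iff:
  assumes "finite (carrier G)" and "Coset.order G > 2"
  shows "G \<in> class_B 2 \<longleftrightarrow>
    (p_group 5 G \<and> group_exponent G = 5) \<or>
    (\<exists>P. sylow_subgroup 5 P G \<and> group_exponent (G\<lparr>carrier := P\<rparr>) = 5 \<and> subgroup_index G P = 2)"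
proof -
  have prime5: "Factorial_Ring.prime (5::nat)"
    by simp
  show ?thesis
  proof
    assume B: "G \<in> class_B 2"
    \<comment> \<open>The elements of \<open>P\<close> have exponents \<open>5 ^ b\<close> and 10,
      hence 5. The fact serves both alternatives, with \<open>P\<close> the whole carrier in the
      first.\<close>
    have exponent: "group_exponent (G\<lparr>carrier := P\<rparr>) = 5"
      if P: "subgroup P G" and card: "card P = 5 ^ b" and b: "b \<noteq> 0" for P b
    proof -
      interpret P: subgroup P G by fact
      interpret GP: group "G\<lparr>carrier := P\<rparr>"
        by (rule P.subgroup_is_group) (rule is_group)
      have "x [^]\<^bsub>G\<lparr>carrier := P\<rparr>\<^esub> (5::nat) = \<one>\<^bsub>G\<lparr>carrier := P\<rparr>\<^esub>" if x: "x \<in> carrier (G\<lparr>carrier := P\<rparr>)" for x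
      proof -
        have xG: "x \<in> carrier G"
          using x P.subset by auto
        have "x [^] (5 ^ b :: nat) = \<one>"
          using GP.pow_order_eq_1[OF x] card by (simp add: Coset.order_def nat_pow_consistent[symmetric])
        moreover have "coprime (5 ^ b) (2::nat)"
          by simp
        then have "gcd (5 ^ b) (5 * 2) dvd (5::nat)"
          by (metis coprime_dvd_mult_left_iff coprime_divisors dvd_refl gcd_dvd1 gcd_dvd2)
        ultimately show ?thesis
          using pow_gcd_eq_one[OF xG _ class_B_pow_ten[OF B xG], of "5 ^ b" 5]
          by (simp add: nat_pow_consistent[symmetric])
      qed
      moreover have "card P > 1"
        using b one_less_power[of "5::nat" b] by (simp add: card)
      then have "P \<noteq> {\<one>}"
        by auto
      ultimately show ?thesis
        by (intro GP.group_exponent_eq_primeI prime5) simp_all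
    qed
    obtain b where b: "Coset.order G = 5 ^ b \<or> Coset.order G = 2 * 5 ^ b"
      using order_if_pow_ten[OF assms(1)] class_B_pow_ten[OF B] class_B_order_not_dvd_four[OF B] by blast
    \<comment> \<open>Here \<open>order G > 2\<close> excludes the orders 1 and 2.\<close>
    then have "b \<noteq> 0"
      using assms(2) by (cases b) auto
    from b show "(p_group 5 G \<and> group_exponent G = 5) \<or>
      (\<exists>P. sylow_subgroup 5 P G \<and> group_exponent (G\<lparr>carrier := P\<rparr>) = 5 \<and> subgroup_index G P = 2)"
    proof
      assume order: "Coset.order G = 5 ^ b"
      then have "group_exponent (G\<lparr>carrier := carrier G\<rparr>) = 5"
        using \<open>b \<noteq> 0\<close> by (intro exponent[of _ b] subgroup_self) (simp_all add: Coset.order_def)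
      then show ?thesis
        using order is_group by (auto simp: p_group_def)
    next
      assume order: "Coset.order G = 2 * 5 ^ b"
      then obtain P where P: "subgroup P G" "card P = 5 ^ b"
        using sylow_thm[OF prime5 is_group _ assms(1), of b 2] by (auto simp: mult.commute)
      have "multiplicity 5 (2 * 5 ^ b :: nat) = multiplicity 5 (2::nat) + multiplicity 5 (5 ^ b :: nat)"
        by (rule prime_elem_multiplicity_mult_distrib) simp_all
      then have "multiplicity 5 (2 * 5 ^ b :: nat) = b"
        by (simp add: not_dvd_imp_multiplicity_0)
      then have "sylow_subgroup 5 P G"
        using P by (simp add: sylow_subgroup_def order)
      moreover have "subgroup_index G P = 2"
        using lagrange[OF P(1)] P(2) order by (simp add: subgroup_index_def)
      ultimately show ?thesis
        using exponent[OF P \<open>b \<noteq> 0\<close>] by blast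
    qed
  next
    assume "(p_group 5 G \<and> group_exponent G = 5) \<or>
      (\<exists>P. sylow_subgroup 5 P G \<and> group_exponent (G\<lparr>carrier := P\<rparr>) = 5 \<and> subgroup_index G P = 2)"
    \<comment> \<open>Both alternatives are merged: \<open>P\<close> is the whole carrier or the
      Sylow subgroup of index 2. Closure under products of outside elements is vacuous in the first
      case.\<close>
    then obtain P where P: "subgroup P G" and P5: "\<And>x. x \<in> P \<Longrightarrow> x [^] (5::nat) = \<one>"
      and mult: "\<And>a b. a \<in> carrier G \<Longrightarrow> b \<in> carrier G \<Longrightarrow> a \<notin> P \<Longrightarrow> b \<notin> P \<Longrightarrow> a \<otimes> b \<in> P"
    proof (elim disjE conjE exE)
      assume "group_exponent G = 5"
      then have "x [^] (5::nat) = \<one>" if "x \<in> carrier G" for x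
        using group_exponent_pow[OF assms(1) that] by simp
      then show ?thesis
        by (rule that[OF subgroup_self]) simp_all
    next
      fix P assume P: "sylow_subgroup 5 P G" "group_exponent (G\<lparr>carrier := P\<rparr>) = 5" "subgroup_index G P = 2"
      then interpret P: subgroup P G
        by (simp add: sylow_subgroup_def)
      interpret GP: group "G\<lparr>carrier := P\<rparr>"
        by (rule P.subgroup_is_group) (rule is_group)
      have exp5: "x [^] (5::nat) = \<one>" if "x \<in> P" for x
        using GP.group_exponent_pow[of x] that P(2) finite_subset[OF P.subset assms(1)]
        by (simp add: nat_pow_consistent[symmetric])
      show ?thesis
        by (rule that[OF P.subgroup_axioms exp5 index_two_mult_closed[OF P.subgroup_axioms P(3)]])
    qed
    interpret P: subgroup P G by fact
    have sq: "x \<otimes> x \<in> P" if "x \<in> carrier G" for x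
      using mult[OF that that] by (cases "x \<in> P") auto
    show "G \<in> class_B 2"
    proof (rule class_BI[OF assms(1)])
      fix x assume x: "x \<in> carrier G"
      have "x [^] (10::nat) = (x [^] (2::nat)) [^] (5::nat)"
        using x by (simp add: nat_pow_pow)
      then show "x [^] (10::nat) = \<one>"
        using P5 sq x by (simp add: pow_two)
    next
      \<comment> \<open>Exponents 5 and 2 are coprime, so involutions lie outside \<open>P\<close>,
        and the product of two of them falls into \<open>P\<close>.\<close>
      have notin: "s \<notin> P" if "s \<in> carrier G" "s \<noteq> \<one>" "s \<otimes> s = \<one>" for s
      proof
        assume "s \<in> P"
        then have "s [^] (5::nat) = \<one>"
          by (rule P5)
        then show False
          using pow_gcd_eq_one[of s 5 2 1] that by (simp add: pow_two)
      qed
      fix s t assume "s \<in> carrier G" "t \<in> carrier G" "s \<noteq> \<one>" "t \<noteq> \<one>" "s \<otimes> s = \<one>" "t \<otimes> t = \<one>"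
      then show "(t \<otimes> s) [^] (5::nat) = \<one>"
        by (intro P5 mult notin)
    qed
  qed
qed

theorem theorem6p5:
  fixes G :: "('a, 'b) monoid_scheme"
  assumes "group G" and "finite (carrier G)"
    and "Coset.order G > 2"
  shows "G \<in> class_B 2 \<longleftrightarrow>
    (p_group 5 G \<and> group_exponent G = 5) \<or>
    (\<exists>P. sylow_subgroup 5 P G \<and> group_exponent (G\<lparr>carrier := P\<rparr>) = 5 \<and> subgroup_index G P = 2)"
  using group.class_B_two_iff[OF assms] .

end
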